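(* The wasted space in packing a square of sidelength $x$ by unit squares satisfies $W(x) = O(x^{3/5})$ as $x \to \infty$; that is, there exist absolute constants $C > 0$ and $x_0 > 0$ such that for every real number $x \ge x_0$, $$W(x) \le C\, x^{3/5}.$$
   Context: For a real number $x>0$, let $S(x)$ denote a (closed) square in the Euclidean plane of sidelength $x$. A packing of $S(x)$ by unit squares is a finite collection of closed squares of sidelength $1$, each contained in $S(x)$, with pairwise disjoint interiors; the unit squares may be placed in arbitrary positions and arbitrary orientations (they need not be parallel to the sides of $S(x)$ or to each other). The wasted space $W(x)$ is the minimum, over all such packings, of the area of the part of $S(x)$ left uncovered by the unit squares; equivalently, $W(x) = x^2 - N(x)$, where $N(x)$ is the maximum number of unit squares in a packing of $S(x)$. *)

theory Defs
  imports "HOL-Analysis.Analysis"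
begin

type_synonym plane = "real ^ 2"

text \<open>The orthonormal pair \<open>u, v\<close> gives the directions of the sides, so every position and every
  orientation is allowed.\<close>

definition closed_square :: "real \<Rightarrow> plane set \<Rightarrow> bool" where
  "closed_square s Q \<longleftrightarrow>
     (\<exists>p u v. norm u = 1 \<and> norm v = 1 \<and> u \<bullet> v = 0 \<and>
        Q = {p + a *\<^sub>R u + b *\<^sub>R v | a b. 0 \<le> a \<and> a \<le> s \<and> 0 \<le> b \<and> b \<le> s})"

text \<open>The large square is only relevant up to congruence; we fix the representative
  \<open>[0, x] \<times> [0, x]\<close>.\<close>

definition big_square :: "real \<Rightarrow> plane set" where
  "big_square x = cbox 0 (\<chi> i. x)"

definition unit_square_packing :: "plane set \<Rightarrow> plane set set \<Rightarrow> bool" where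
  "unit_square_packing S P \<longleftrightarrow>
     finite P \<and> (\<forall>Q\<in>P. closed_square 1 Q \<and> Q \<subseteq> S) \<and>
     pairwise (\<lambda>Q R. interior Q \<inter> interior R = {}) P"

text \<open>The infimum is a minimum: the uncovered area is \<open>x\<^sup>2 - card P\<close>, so it takes only finitely
  many values. The set is nonempty because \<open>P = {}\<close> is a packing.\<close>

definition wasted_space :: "real \<Rightarrow> real" where
  "wasted_space x =
     Inf {measure lebesgue (big_square x - \<Union>P) | P. unit_square_packing (big_square x) P}"

lemma closed_square_big_square: "closed_square x (big_square x)"
proof -
  have "big_square x =
    {0 + a *\<^sub>R axis 1 1 + b *\<^sub>R axis 2 1 | a b. 0 \<le> a \<and> a \<le> x \<and> 0 \<le> b \<and> b \<le> x}"
    (is "_ = ?R")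
  proof (intro set_eqI iffI)
    fix y assume "y \<in> big_square x"
    then have "0 \<le> y $ 1 \<and> y $ 1 \<le> x \<and> 0 \<le> y $ 2 \<and> y $ 2 \<le> x"
      by (simp add: big_square_def mem_box_cart)
    moreover have "y = 0 + (y $ 1) *\<^sub>R axis 1 1 + (y $ 2) *\<^sub>R axis 2 1"
      by (simp add: vec_eq_iff forall_2 axis_def)
    ultimately show "y \<in> ?R" by blast
  next
    fix y assume "y \<in> ?R"
    then show "y \<in> big_square x"
      by (auto simp: big_square_def mem_box_cart forall_2 axis_def)
  qed
  moreover have "axis 1 1 \<bullet> (axis 2 1 :: plane) = 0"
    by (simp add: inner_axis_axis)
  ultimately show ?thesis
    unfolding closed_square_def
    by (intro exI[of _ 0] exI[of _ "axis 1 1"] exI[of _ "axis 2 1"]) (simp only: norm_axis_1 simp_thms)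
qed

lemma unit_square_packing_empty: "unit_square_packing S {}"
  by (simp add: unit_square_packing_def)

end

theory Submission imports Defs begin

text \<open>Let \<open>q\<close> be of order \<open>x\<^sup>1\<^sup>/\<^sup>5\<close>. Cut off an integer square and two strips of width \<open>h\<close> of order
  \<open>q\<^sup>4\<close>. In a strip, put rods of \<open>n > h\<close> unit squares across it, tilted with slope \<open>1/q\<^sup>2\<close> so
  that they just fit; each rod wastes \<open>O(1/q\<^sup>2)\<close>, and a trapezoid of height \<open>h\<close> remains at either
  end, with one vertical side and one side (the wall) of slope \<open>1/q\<^sup>2\<close>. It has to be packed with
  waste \<open>O(q\<^sup>3)\<close>, that is \<open>O(1/q)\<close> per unit of height.

  Pack it by layers of long, nearly horizontal rods of slope \<open>t\<close> of order \<open>1/q\<close>. Write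
  \<open>c = sqrt (1 + t\<^sup>2)\<close>. Replacing \<open>s\<close> squares of a tilted rod by \<open>s\<close> axis-parallel ones takes
  \<open>s (1 - 1/c)\<close> more room, and \<open>q\<close> rows further up the wall has receded by \<open>1/q\<close>; so after every \<open>q\<close>
  rods the rods are shortened by \<open>s\<close>, of order \<open>q\<close>, which keeps them flush with the wall. Their left
  ends form a staircase of ledges. The space above the ledges is filled by axis-parallel columns
  reaching up to the first rod of the next layer. A tilted rod has vertical thickness \<open>c\<close>, so the
  columns would fall short of integer height by an amount that changes by \<open>q (c - 1)\<close> from one ledge
  to the next; this is linear along the staircase, and starting the next layer with slope
  \<open>t' = t + q (c - 1) / s\<close> removes it. Such a layer of \<open>q\<^sup>2\<close> rods, the longest having \<open>L\<close> squares,
  contains exactly \<open>q\<^sup>2 L\<close> squares. Over \<open>q\<close> layers the slope only drifts from \<open>1/(2q)\<close> to at most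
  \<open>1/q\<close>; then the block is closed off by columns, at a cost of \<open>O(q\<^sup>2)\<close> for a height of order \<open>q\<^sup>3\<close>.\<close>

subsection \<open>Packing numbers of plane regions\<close>

definition packable :: "plane set \<Rightarrow> nat \<Rightarrow> bool" where
  "packable S n \<longleftrightarrow> (\<exists>P. unit_square_packing S P \<and> card P = n)"

section \<open>Areas of unit squares and the uncovered part of a packing\<close>

lemma measure_closed_square:
  assumes "closed_square 1 Q"
  shows "Q \<in> lmeasurable" "measure lebesgue Q = 1" "negligible (frontier Q)" "closed Q" "bounded Q"
proof -
  obtain p u v where uv: "norm u = 1" "norm v = 1" "u \<bullet> v = 0"
    and Q: "Q = {p + a *\<^sub>R u + b *\<^sub>R v | a b. 0 \<le> a \<and> a \<le> 1 \<and> 0 \<le> b \<and> b \<le> 1}"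
    using assms unfolding closed_square_def by blast
  define f where "f = (\<lambda>z :: plane. z $ 1 *\<^sub>R u + z $ 2 *\<^sub>R v)"
  have lin: "linear f"
    unfolding f_def by (rule linearI) (auto simp: algebra_simps)
  have "f x \<bullet> f y = x \<bullet> y" for x y
  proof -
    have "u \<bullet> u = 1" "v \<bullet> v = 1" "v \<bullet> u = 0"
      using uv by (auto simp: norm_eq_1 inner_commute)
    then have "f x \<bullet> f y = x $ 1 * y $ 1 + x $ 2 * y $ 2"
      using uv(3) by (simp add: f_def inner_add_left inner_add_right)
    then show ?thesis by (simp add: inner_vec_def sum_2)
  qed
  then have orth: "orthogonal_transformation f"
    using lin by (simp add: orthogonal_transformation_def)
  have Qf: "Q = (+) p ` f ` cbox 0 1"
  proof (intro set_eqI iffI)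
    fix z assume "z \<in> Q"
    then obtain a b where ab: "z = p + a *\<^sub>R u + b *\<^sub>R v" "0 \<le> a" "a \<le> 1" "0 \<le> b" "b \<le> 1"
      using Q by blast
    have "vector [a, b] \<in> cbox 0 (1 :: plane)" "z = p + f (vector [a, b])"
      using ab by (auto simp: mem_box_cart forall_2 f_def)
    then show "z \<in> (+) p ` f ` cbox 0 1" by blast
  next
    fix z assume "z \<in> (+) p ` f ` cbox 0 1"
    then obtain w where "w \<in> cbox 0 (1 :: plane)" "z = p + w $ 1 *\<^sub>R u + w $ 2 *\<^sub>R v"
      by (auto simp: f_def add.assoc)
    then show "z \<in> Q"
      unfolding Q by (auto simp: mem_box_cart forall_2)
  qed
  have m: "f ` cbox 0 1 \<in> lmeasurable"
    using measurable_orthogonal_image[OF orth] by auto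
  have "measure lebesgue (f ` cbox 0 1) = measure lebesgue (cbox 0 (1 :: plane))"
    using measure_orthogonal_image[OF orth] by auto
  also have "\<dots> = 1"
    by (simp add: content_cbox_cart interval_eq_empty_cart not_less)
  finally show "measure lebesgue Q = 1"
    unfolding Qf by (simp add: measure_translation)
  show "Q \<in> lmeasurable"
    unfolding Qf using m by (simp add: measurable_translation)
  have "convex Q"
    unfolding Qf by (intro convex_translation convex_linear_image lin convex_box)
  then show "negligible (frontier Q)"
    by (rule negligible_convex_frontier)
  have "compact (f ` cbox 0 1)"
    by (intro compact_continuous_image linear_continuous_on compact_cbox)
       (use lin linear_conv_bounded_linear in blast)
  then have "compact Q"
    unfolding Qf by (intro compact_translation)
  then show "closed Q" "bounded Q"
    by (auto intro: compact_imp_closed compact_imp_bounded)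
qed

lemma measure_interior_closed_square:
  assumes "closed_square 1 Q"
  shows "measure lebesgue (interior Q) = 1" "interior Q \<noteq> {}" "interior Q \<in> lmeasurable"
proof -
  show "interior Q \<in> lmeasurable"
    using measure_closed_square(5)[OF assms] by (rule lmeasurable_interior)
  have "sym_diff Q (interior Q) = frontier Q"
    using interior_subset[of Q] closure_closed[OF measure_closed_square(4)[OF assms]]
    unfolding frontier_def by blast
  then have "negligible (sym_diff Q (interior Q))"
    using measure_closed_square(3)[OF assms] by simp
  then have "measure lebesgue (interior Q) = measure lebesgue Q"
    using measure_closed_square(1)[OF assms] by (rule measure_negligible_symdiff[rotated])
  then show "measure lebesgue (interior Q) = 1"
    using measure_closed_square[OF assms] by simp
  then show "interior Q \<noteq> {}" by auto
qed

text \<open>The interiors, unlike the squares themselves, are disjoint sets, so their areas add up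
  to \<open>n\<close>. Replacing squares by interiors only enlarges the uncovered part, which is
  harmless for an upper bound.\<close>

lemma wasted_space_le:
  assumes "packable (big_square x) n" "0 \<le> x"
  shows "wasted_space x \<le> x\<^sup>2 - n"
proof -
  obtain P where P: "unit_square_packing (big_square x) P" "card P = n"
    using assms(1) unfolding packable_def by blast
  let ?S = "big_square x"
  have fin: "finite P" and sq: "\<And>Q. Q \<in> P \<Longrightarrow> closed_square 1 Q \<and> Q \<subseteq> ?S"
    and dis: "\<And>Q R. Q \<in> P \<Longrightarrow> R \<in> P \<Longrightarrow> Q \<noteq> R \<Longrightarrow> interior Q \<inter> interior R = {}"
    using P(1) by (auto simp: unit_square_packing_def pairwise_def)
  have mS: "measure lebesgue ?S = x\<^sup>2"
    using assms(2) by (simp add: big_square_def content_cbox_cart interval_eq_empty_cart not_less UNIV_2 power2_eq_square)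
  have S: "?S \<in> lmeasurable" by (simp add: big_square_def)
  let ?U = "\<Union>Q\<in>P. interior Q"
  have U: "?U \<in> lmeasurable"
    using measure_interior_closed_square sq fin by (intro fmeasurable.finite_UN) auto
  have "measure lebesgue ?U = (\<Sum>Q\<in>P. measure lebesgue (interior Q))"
    using fin dis measure_interior_closed_square sq
    by (intro measure_UNION') (auto simp: pairwise_def disjnt_def)
  also have "\<dots> = n"
    using measure_interior_closed_square sq P(2) by simp
  finally have mU: "measure lebesgue ?U = n" .
  have "?U \<subseteq> ?S" using sq interior_subset by blast
  have UP: "\<Union>P \<in> lmeasurable"
    using measure_closed_square sq fin by (intro fmeasurable.finite_Union) auto
  have "measure lebesgue (?S - \<Union>P) \<le> measure lebesgue (?S - ?U)"
    using S U UP interior_subset by (intro measure_mono_fmeasurable) (auto intro: fmeasurable.Diff)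
  also have "\<dots> = x\<^sup>2 - n"
    using S U \<open>?U \<subseteq> ?S\<close> by (subst measurable_measure_Diff) (auto simp: mS mU)
  finally have le: "measure lebesgue (?S - \<Union>P) \<le> x\<^sup>2 - n" .
  have "wasted_space x \<le> measure lebesgue (?S - \<Union>P)"
    unfolding wasted_space_def
    by (rule cInf_lower) (use P(1) in \<open>auto intro!: bdd_belowI[of _ 0]\<close>)
  then show ?thesis using le by linarith
qed

section \<open>Combining and moving packings\<close>

lemma packable_mono: "packable S n \<Longrightarrow> S \<subseteq> T \<Longrightarrow> packable T n"
  unfolding packable_def unit_square_packing_def by blast

lemma packable_0: "packable S 0"
  unfolding packable_def using unit_square_packing_empty by fastforce

lemma packable_Un:
  assumes A: "packable A m" and B: "packable B n" and "A \<subseteq> S" "B \<subseteq> S"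
    and sep: "interior A \<inter> interior B = {}"
  shows "packable S (m + n)"
proof -
  obtain P R where P: "unit_square_packing A P" "card P = m" and R: "unit_square_packing B R" "card R = n"
    using A B unfolding packable_def by blast
  have cross: "interior Q \<inter> interior Q' = {}" if "Q \<in> P" "Q' \<in> R" for Q Q'
  proof -
    have "Q \<subseteq> A" "Q' \<subseteq> B"
      using that P R by (simp_all add: unit_square_packing_def)
    then show ?thesis using sep interior_mono by blast
  qed
  \<comment> \<open>A common square would have an interior disjoint from itself, but that interior
    has measure 1. Hence the cardinalities add.\<close>
  have "P \<inter> R = {}"
  proof (rule ccontr)
    assume "P \<inter> R \<noteq> {}"
    then obtain Q where "Q \<in> P" "Q \<in> R" by blast
    then show False
      using cross[of Q Q] measure_interior_closed_square(2)[of Q] P by (auto simp: unit_square_packing_def)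
  qed
  moreover have "finite P" "finite R" using P R by (auto simp: unit_square_packing_def)
  ultimately have "card (P \<union> R) = m + n" using P R by (simp add: card_Un_disjoint)
  moreover have "unit_square_packing S (P \<union> R)"
    unfolding unit_square_packing_def
  proof (intro conjI ballI)
    show "finite (P \<union> R)" using \<open>finite P\<close> \<open>finite R\<close> by simp
    show "closed_square 1 Q" "Q \<subseteq> S" if "Q \<in> P \<union> R" for Q
      using that P(1) R(1) assms(3,4) unfolding unit_square_packing_def by blast+
    show "pairwise (\<lambda>Q R. interior Q \<inter> interior R = {}) (P \<union> R)"
      using P(1) R(1) cross unfolding unit_square_packing_def pairwise_def by (metis Int_commute Un_iff)
  qed
  ultimately show ?thesis unfolding packable_def by blast
qed

lemma interior_separated:
  fixes A B :: "plane set"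
  assumes "\<And>z. z \<in> A \<Longrightarrow> \<alpha> * z $ 1 + \<beta> * z $ 2 \<le> \<gamma>"
    and "\<And>z. z \<in> B \<Longrightarrow> \<gamma> \<le> \<alpha> * z $ 1 + \<beta> * z $ 2" and "\<alpha> \<noteq> 0 \<or> \<beta> \<noteq> 0"
  shows "interior A \<inter> interior B = {}"
proof -
  define a :: plane where "a = vector [\<alpha>, \<beta>]"
  have a: "a \<noteq> 0" using assms(3) by (auto simp: a_def vec_eq_iff forall_2)
  have ip: "a \<bullet> z = \<alpha> * z $ 1 + \<beta> * z $ 2" for z by (simp add: a_def inner_vec_def sum_2)
  have "interior A \<subseteq> {z. a \<bullet> z < \<gamma>}" "interior B \<subseteq> {z. a \<bullet> z > \<gamma>}"
    using interior_mono[of A "{z. a \<bullet> z \<le> \<gamma>}"] interior_mono[of B "{z. a \<bullet> z \<ge> \<gamma>}"]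
      assms(1,2) interior_halfspace_le[OF a] interior_halfspace_ge[OF a] by (auto simp: ip)
  then show ?thesis by fastforce
qed

lemma packable_Un_line:
  assumes "packable A m" "packable B n" "A \<subseteq> S" "B \<subseteq> S"
    and "\<And>z. z \<in> A \<Longrightarrow> \<alpha> * z $ 1 + \<beta> * z $ 2 \<le> \<gamma>"
    and "\<And>z. z \<in> B \<Longrightarrow> \<gamma> \<le> \<alpha> * z $ 1 + \<beta> * z $ 2" and "\<alpha> \<noteq> 0 \<or> \<beta> \<noteq> 0"
  shows "packable S (m + n)"
  using packable_Un[OF assms(1-4) interior_separated[OF assms(5-7)]] by simp

lemma packable_isometry:
  assumes S: "packable S n" and f: "orthogonal_transformation f"
  shows "packable ((\<lambda>z. p + f z) ` S) n"
proof -
  let ?g = "\<lambda>z. p + f z"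
  obtain P where P: "unit_square_packing S P" "card P = n"
    using S unfolding packable_def by blast
  have lin: "linear f" using f orthogonal_transformation_linear by blast
  have bij: "bij ?g"
    using bij_comp[OF orthogonal_transformation_bij[OF f] bij_plus_right[of p]] by (simp add: comp_def add.commute)
  have cont: "continuous_on UNIV ?g"
    by (intro continuous_intros linear_continuous_on) (use lin linear_conv_bounded_linear in blast)
  \<comment> \<open>Preimages of interiors under the continuous bijection \<open>?g\<close> are
    open, so a common interior point of two images comes from a common interior point of the
    originals.\<close>
  have int: "w \<in> interior A" if "?g w \<in> interior (?g ` A)" for w A
  proof -
    have "open (?g -` interior (?g ` A))"
      using cont open_interior by (metis continuous_on_open_vimage open_UNIV Int_UNIV_right)
    moreover have "?g -` interior (?g ` A) \<subseteq> A"
      using interior_subset bij by (force simp: bij_def inj_def)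
    ultimately show ?thesis using that by (meson interiorI vimageI2 subset_iff interior_maximal)
  qed
  have "unit_square_packing (?g ` S) (image ?g ` P)"
    unfolding unit_square_packing_def
  proof (intro conjI ballI)
    show "finite (image ?g ` P)" using P by (auto simp: unit_square_packing_def)
    fix Q assume "Q \<in> image ?g ` P"
    then obtain R where R: "R \<in> P" "Q = ?g ` R" by blast
    then show "Q \<subseteq> ?g ` S" using P by (auto simp: unit_square_packing_def)
    have "closed_square 1 R" using R P by (auto simp: unit_square_packing_def)
    then obtain c u v where uv: "norm u = 1" "norm v = 1" "u \<bullet> v = 0"
      and RR: "R = {c + a *\<^sub>R u + b *\<^sub>R v | a b. 0 \<le> a \<and> a \<le> 1 \<and> 0 \<le> b \<and> b \<le> 1}"
      unfolding closed_square_def by blast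
    have g: "?g (c + a *\<^sub>R u + b *\<^sub>R v) = ?g c + a *\<^sub>R f u + b *\<^sub>R f v" for a b
      using lin by (simp add: linear_add linear_cmul)
    have "Q = {?g c + a *\<^sub>R f u + b *\<^sub>R f v | a b. 0 \<le> a \<and> a \<le> 1 \<and> 0 \<le> b \<and> b \<le> 1}"
    proof -
      have "Q = {?g (c + a *\<^sub>R u + b *\<^sub>R v) | a b. 0 \<le> a \<and> a \<le> 1 \<and> 0 \<le> b \<and> b \<le> 1}"
        unfolding R RR by blast
      then show ?thesis unfolding g .
    qed
    moreover have "norm (f u) = 1" "norm (f v) = 1" "f u \<bullet> f v = 0"
      using uv f by (auto simp: orthogonal_transformation_def orthogonal_transformation_norm)
    ultimately show "closed_square 1 Q" unfolding closed_square_def by blast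
  next
    show "pairwise (\<lambda>Q R. interior Q \<inter> interior R = {}) (image ?g ` P)"
    proof (clarsimp simp: pairwise_def)
      fix Q R assume QR: "Q \<in> P" "R \<in> P" "?g ` Q \<noteq> ?g ` R"
      then have "Q \<noteq> R" by blast
      then have "interior Q \<inter> interior R = {}"
        using QR P by (simp add: unit_square_packing_def pairwise_def)
      show "interior (?g ` Q) \<inter> interior (?g ` R) = {}"
      proof (rule ccontr)
        assume "interior (?g ` Q) \<inter> interior (?g ` R) \<noteq> {}"
        then obtain w where "?g w \<in> interior (?g ` Q)" "?g w \<in> interior (?g ` R)"
          using interior_subset by blast
        then show False
          using int \<open>interior Q \<inter> interior R = {}\<close> by blast
      qed
    qed
  qed
  moreover have "card (image ?g ` P) = n"
    using P(2) card_image[OF inj_on_image[OF inj_on_subset[OF bij_is_inj[OF bij]]]] by simp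
  ultimately show ?thesis unfolding packable_def by blast
qed

lemma packable_translate:
  assumes "packable {z. P (z $ 1) (z $ 2)} n"
  shows "packable {z. P (z $ 1 - a) (z $ 2 - b)} n"
proof -
  have "packable ((\<lambda>z :: plane. vector [a, b] + z) ` {z. P (z $ 1) (z $ 2)}) n"
    using packable_isometry[OF assms orthogonal_transformation_id] by simp
  then show ?thesis
  proof (rule packable_mono)
    show "(\<lambda>z :: plane. vector [a, b] + z) ` {z. P (z $ 1) (z $ 2)} \<subseteq> {z. P (z $ 1 - a) (z $ 2 - b)}"
      by auto
  qed
qed

lemma packable_rotate:
  assumes "packable {z. P (z $ 1) (z $ 2)} n"
  shows "packable {z. P (a - z $ 1) (b - z $ 2)} n"
proof -
  have "orthogonal_transformation (uminus :: plane \<Rightarrow> plane)"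
    by (simp add: orthogonal_transformation_def linear_uminus)
  from packable_isometry[OF assms this]
  have "packable ((\<lambda>z :: plane. vector [a, b] + - z) ` {z. P (z $ 1) (z $ 2)}) n" .
  then show ?thesis
  proof (rule packable_mono)
    show "(\<lambda>z :: plane. vector [a, b] + - z) ` {z. P (z $ 1) (z $ 2)} \<subseteq> {z. P (a - z $ 1) (b - z $ 2)}"
      by auto
  qed
qed

lemma packable_swap:
  assumes "packable {z. P (z $ 1) (z $ 2)} n"
  shows "packable {z. P (z $ 2) (z $ 1)} n"
proof -
  define f where "f = (\<lambda>z :: plane. vector [z $ 2, z $ 1] :: plane)"
  have "linear f"
    by (rule linearI) (auto simp: f_def vec_eq_iff forall_2)
  then have "orthogonal_transformation f"
    by (simp add: orthogonal_transformation_def f_def inner_vec_def sum_2 add.commute)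
  from packable_isometry[OF assms this, of 0]
  have "packable (f ` {z. P (z $ 1) (z $ 2)}) n" by simp
  then show ?thesis
    by (rule packable_mono) (auto simp: f_def)
qed

subsection \<open>Rods, columns and rows\<close>

text \<open>Orthonormal coordinates: \<open>a\<close> runs along the direction
  \<open>(1, t) / sqrt (1 + t\<^sup>2)\<close> and \<open>b\<close> across it, with
  \<open>(x, y)\<close> at \<open>a = b = 0\<close>. A variable range of \<open>a\<close> lets a rod
  be cut into unit squares with a common origin.\<close>

definition rod :: "real \<Rightarrow> real \<Rightarrow> real \<Rightarrow> real \<Rightarrow> real \<Rightarrow> plane set" where
  "rod t x y l m = {z. \<exists>a b. l \<le> a \<and> a \<le> m \<and> 0 \<le> b \<and> b \<le> 1 \<and>
     z $ 1 = x + (a - t * b) / sqrt (1 + t\<^sup>2) \<and> z $ 2 = y + (t * a + b) / sqrt (1 + t\<^sup>2)}"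

lemma sqrt_one_plus_square: "0 < sqrt (1 + t\<^sup>2)" "1 \<le> sqrt (1 + t\<^sup>2)" "sqrt (1 + t\<^sup>2) * sqrt (1 + t\<^sup>2) = 1 + t\<^sup>2"
  by (auto simp: add_pos_nonneg)

lemma packable_unit_square: "closed_square 1 Q \<Longrightarrow> packable Q 1"
  unfolding packable_def unit_square_packing_def by (intro exI[of _ "{Q}"]) auto

lemma rod_mono:
  assumes "l' \<le> l" "m \<le> m'"
  shows "rod t x y l m \<subseteq> rod t x y l' m'"
proof
  fix z assume "z \<in> rod t x y l m"
  then obtain a b where "l \<le> a" "a \<le> m" "0 \<le> b" "b \<le> 1"
    "z $ 1 = x + (a - t * b) / sqrt (1 + t\<^sup>2)" "z $ 2 = y + (t * a + b) / sqrt (1 + t\<^sup>2)"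
    unfolding rod_def by blast
  then show "z \<in> rod t x y l' m'"
    unfolding rod_def using assms by (intro CollectI exI[of _ a] exI[of _ b]) auto
qed

text \<open>Up to a constant, the functional is \<open>sqrt (1 + t\<^sup>2)\<close> times the
  coordinate \<open>a\<close>; it separates consecutive pieces of a rod.\<close>

lemma rod_functional:
  assumes "z \<in> rod t x y l m"
  shows "x + t * y + l * sqrt (1 + t\<^sup>2) \<le> 1 * z $ 1 + t * z $ 2"
    "1 * z $ 1 + t * z $ 2 \<le> x + t * y + m * sqrt (1 + t\<^sup>2)"
proof -
  let ?c = "sqrt (1 + t\<^sup>2)"
  obtain a b where ab: "l \<le> a" "a \<le> m" "z $ 1 = x + (a - t * b) / ?c" "z $ 2 = y + (t * a + b) / ?c"
    using assms unfolding rod_def by blast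
  have "1 * z $ 1 + t * z $ 2 = x + t * y + a * (1 + t\<^sup>2) / ?c"
    using sqrt_one_plus_square(1)[of t] by (simp add: ab field_simps power2_eq_square)
  also have "a * (1 + t\<^sup>2) / ?c = a * ?c"
    using sqrt_one_plus_square(1,3)[of t] by (metis nonzero_mult_div_cancel_right less_irrefl mult.assoc)
  finally show "x + t * y + l * ?c \<le> 1 * z $ 1 + t * z $ 2" "1 * z $ 1 + t * z $ 2 \<le> x + t * y + m * ?c"
    using ab sqrt_one_plus_square(1)[of t] by auto
qed

lemma packable_rod: "packable (rod t x y 0 (real m)) m"
proof (induction m)
  case 0
  then show ?case by (rule packable_0)
next
  case (Suc m)
  let ?c = "sqrt (1 + t\<^sup>2)"
  have c: "?c > 0" "?c * ?c = 1 + t\<^sup>2" using sqrt_one_plus_square[of t] by auto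
  define u v p where "u = (vector [1 / ?c, t / ?c] :: plane)" and "v = (vector [- t / ?c, 1 / ?c] :: plane)"
    and "p = (vector [x + m / ?c, y + t * m / ?c] :: plane)"
  have "u \<bullet> u = 1" "v \<bullet> v = 1" "u \<bullet> v = 0"
    using c by (auto simp: u_def v_def inner_vec_def sum_2 field_simps power2_eq_square)
  then have uv: "norm u = 1" "norm v = 1" "u \<bullet> v = 0" by (auto simp: norm_eq_1)
  have eq: "rod t x y m (real m + 1) = {p + a *\<^sub>R u + b *\<^sub>R v | a b. 0 \<le> a \<and> a \<le> 1 \<and> 0 \<le> b \<and> b \<le> 1}"
  proof (intro set_eqI iffI)
    fix z assume "z \<in> rod t x y m (real m + 1)"
    then obtain a b where ab: "real m \<le> a" "a \<le> real m + 1" "0 \<le> b" "b \<le> 1"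
      "z $ 1 = x + (a - t * b) / ?c" "z $ 2 = y + (t * a + b) / ?c" unfolding rod_def by blast
    have "z = p + (a - m) *\<^sub>R u + b *\<^sub>R v"
      by (auto simp: vec_eq_iff forall_2 ab p_def u_def v_def add_divide_distrib diff_divide_distrib algebra_simps)
    then show "z \<in> {p + a *\<^sub>R u + b *\<^sub>R v | a b. 0 \<le> a \<and> a \<le> 1 \<and> 0 \<le> b \<and> b \<le> 1}"
      using ab by (intro CollectI exI[of _ "a - m"] exI[of _ b]) auto
  next
    fix z assume "z \<in> {p + a *\<^sub>R u + b *\<^sub>R v | a b. 0 \<le> a \<and> a \<le> 1 \<and> 0 \<le> b \<and> b \<le> 1}"
    then obtain a b where ab: "z = p + a *\<^sub>R u + b *\<^sub>R v" "0 \<le> a" "a \<le> 1" "0 \<le> b" "b \<le> 1" by blast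
    show "z \<in> rod t x y m (real m + 1)"
      unfolding rod_def using ab c(1)
      by (intro CollectI exI[of _ "m + a"] exI[of _ b]) (auto simp: p_def u_def v_def add_divide_distrib diff_divide_distrib algebra_simps)
  qed
  have "closed_square 1 (rod t x y m (real m + 1))"
    unfolding closed_square_def eq using uv by blast
  then have "packable (rod t x y m (real m + 1)) 1" by (rule packable_unit_square)
  moreover have "rod t x y 0 (real m) \<subseteq> rod t x y 0 (real (Suc m))"
    "rod t x y (real m) (real m + 1) \<subseteq> rod t x y 0 (real (Suc m))"
    by (rule rod_mono; simp)+
  ultimately have "packable (rod t x y 0 (real (Suc m))) (m + 1)"
    using rod_functional[of _ t x y 0 "real m"] rod_functional[of _ t x y "real m" "real m + 1"]
    by (intro packable_Un_line[OF Suc \<open>packable (rod t x y m (real m + 1)) 1\<close>, where \<alpha> = 1 and \<beta> = t and \<gamma> = "x + t * y + m * sqrt (1 + t\<^sup>2)"]) auto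
  then show ?case by simp
qed

lemma packable_block:
  "packable {z. x \<le> z $ 1 \<and> z $ 1 \<le> x + real m \<and> y \<le> z $ 2 \<and> z $ 2 \<le> y + real n} (m * n)"
proof (induction n)
  case 0
  then show ?case by (simp add: packable_0)
next
  case (Suc n)
  have row: "packable {z. x \<le> z $ 1 \<and> z $ 1 \<le> x + real m \<and> y + real n \<le> z $ 2 \<and> z $ 2 \<le> y + real n + 1} m"
    using packable_rod[of 0 x "y + n" m] by (rule packable_mono) (auto simp: rod_def)
  have "packable {z. x \<le> z $ 1 \<and> z $ 1 \<le> x + real m \<and> y \<le> z $ 2 \<and> z $ 2 \<le> y + real (Suc n)} (m * n + m)"
    by (rule packable_Un_line[OF Suc row, where \<alpha> = 0 and \<beta> = 1 and \<gamma> = "y + n"]) auto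
  then show ?case by (simp add: add.commute)
qed

text \<open>All three boundary lines have nonnegative slopes, so a column over
  \<open>[a + i, a + i + 1]\<close> has to be tested only at its lower right corner (lower line and
  wall) and its upper left corner (upper line). The alternative \<open>f i = 0\<close> permits a
  column to be left empty.\<close>

lemma packable_columns:
  fixes f :: "nat \<Rightarrow> nat" and a lA lB tA tB W \<tau> :: real
  assumes nonneg: "0 \<le> tA" "0 \<le> tB" "0 \<le> \<tau>"
    and fit: "\<And>i. i < s \<Longrightarrow> f i = 0 \<or>
      (lA + tA * (a + i + 1) + f i \<le> lB + tB * (a + i) \<and> a + i + 1 \<le> W + \<tau> * (lA + tA * (a + i + 1)))"
  shows "packable {z. a \<le> z $ 1 \<and> z $ 1 \<le> a + real s \<and> lA + tA * z $ 1 \<le> z $ 2 \<and>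
    z $ 2 \<le> lB + tB * z $ 1 \<and> z $ 1 \<le> W + \<tau> * z $ 2} (\<Sum>i<s. f i)"
  using fit
proof (induction s)
  case 0
  then show ?case by (simp add: packable_0)
next
  case (Suc s)
  let ?R = "\<lambda>s :: nat. {z :: plane. a \<le> z $ 1 \<and> z $ 1 \<le> a + real s \<and> lA + tA * z $ 1 \<le> z $ 2 \<and>
    z $ 2 \<le> lB + tB * z $ 1 \<and> z $ 1 \<le> W + \<tau> * z $ 2}"
  have IH: "packable (?R s) (\<Sum>i<s. f i)" using Suc by auto
  let ?y = "lA + tA * (a + s + 1)"
  let ?C = "{z. a + s \<le> z $ 1 \<and> z $ 1 \<le> a + s + 1 \<and> ?y \<le> z $ 2 \<and> z $ 2 \<le> ?y + real (f s)}"
  have C: "packable ?C (f s)"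
    using packable_block[of "a + s" 1 ?y "f s"] by simp
  show ?case
  proof (cases "f s = 0")
    case True
    have "packable (?R (Suc s)) (\<Sum>i<s. f i)"
      by (rule packable_mono[OF IH]) auto
    then show ?thesis using True by simp
  next
    case False
    then have F: "lA + tA * (a + s + 1) + f s \<le> lB + tB * (a + s)" "a + s + 1 \<le> W + \<tau> * (lA + tA * (a + s + 1))"
      using Suc.prems[of s] by auto
    have "?C \<subseteq> ?R (Suc s)"
    proof safe
      fix z :: plane
      assume z: "a + s \<le> z $ 1" "z $ 1 \<le> a + s + 1" "?y \<le> z $ 2" "z $ 2 \<le> ?y + real (f s)"
      have "tA * z $ 1 \<le> tA * (a + s + 1)" "tB * (a + s) \<le> tB * z $ 1" "\<tau> * ?y \<le> \<tau> * z $ 2"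
        using z nonneg by (auto intro: mult_left_mono)
      then show "a \<le> z $ 1" "z $ 1 \<le> a + real (Suc s)" "lA + tA * z $ 1 \<le> z $ 2" "z $ 2 \<le> lB + tB * z $ 1"
        "z $ 1 \<le> W + \<tau> * z $ 2" using z F by auto
    qed
    then have "packable (?R (Suc s)) ((\<Sum>i<s. f i) + f s)"
      by (intro packable_Un_line[OF IH C, where \<alpha> = 1 and \<beta> = 0 and \<gamma> = "a + s"]) auto
    then show ?thesis by simp
  qed
qed

text \<open>The wall recedes with height, so the length of a row is limited at its bottom edge;
  \<open>nat\<close> makes a row empty where the width is negative.\<close>

lemma packable_rows:
  assumes "0 \<le> \<tau>"
  shows "packable {z. 0 \<le> z $ 1 \<and> z $ 1 \<le> W + \<tau> * z $ 2 \<and> 0 \<le> z $ 2 \<and> z $ 2 \<le> real m}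
    (\<Sum>i<m. nat \<lfloor>W + \<tau> * i\<rfloor>)"
proof (induction m)
  case 0
  then show ?case by (simp add: packable_0)
next
  case (Suc m)
  let ?R = "\<lambda>m :: nat. {z :: plane. 0 \<le> z $ 1 \<and> z $ 1 \<le> W + \<tau> * z $ 2 \<and> 0 \<le> z $ 2 \<and> z $ 2 \<le> real m}"
  define k where "k = nat \<lfloor>W + \<tau> * m\<rfloor>"
  have C: "packable {z. 0 \<le> z $ 1 \<and> z $ 1 \<le> real k \<and> m \<le> z $ 2 \<and> z $ 2 \<le> real m + 1} k"
    using packable_block[of 0 k "real m" 1] by simp
  show ?case
  proof (cases "k = 0")
    case True
    have "packable (?R (Suc m)) (\<Sum>i<m. nat \<lfloor>W + \<tau> * i\<rfloor>)"
      by (rule packable_mono[OF Suc]) auto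
    then show ?thesis using True by (simp add: k_def)
  next
    case False
    then have k: "real k \<le> W + \<tau> * m" unfolding k_def by linarith
    have "{z. 0 \<le> z $ 1 \<and> z $ 1 \<le> real k \<and> m \<le> z $ 2 \<and> z $ 2 \<le> real m + 1} \<subseteq> ?R (Suc m)"
    proof safe
      fix z :: plane assume z: "0 \<le> z $ 1" "z $ 1 \<le> real k" "m \<le> z $ 2" "z $ 2 \<le> real m + 1"
      have "\<tau> * m \<le> \<tau> * z $ 2" using z assms by (intro mult_left_mono) auto
      then show "z $ 1 \<le> W + \<tau> * z $ 2" using z k by linarith
    qed auto
    then have "packable (?R (Suc m)) ((\<Sum>i<m. nat \<lfloor>W + \<tau> * i\<rfloor>) + k)"
      by (intro packable_Un_line[OF Suc C, where \<alpha> = 0 and \<beta> = 1 and \<gamma> = "real m"]) auto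
    then show ?thesis by (simp add: k_def)
  qed
qed

lemma rodE:
  assumes "z \<in> rod t x y l m" "c = sqrt (1 + t\<^sup>2)"
  obtains a b where "l \<le> a" "a \<le> m" "0 \<le> b" "b \<le> 1"
    "z $ 1 = x + (a - t * b) / c" "z $ 2 = y + (t * a + b) / c"
  using assms unfolding rod_def by blast

subsection \<open>Layers of tilted rods\<close>

text \<open>Parallel rods of slope \<open>t\<close> have vertical thickness
  \<open>sqrt (1 + t\<^sup>2)\<close>. The hypothesis \<open>fit\<close> says that the lower right
  corner of the lowest rod respects the wall; higher rods have more room.\<close>

lemma packable_batch:
  fixes t \<tau> \<beta> x W :: real and k L :: nat
  assumes t: "0 \<le> t" and \<tau>: "0 \<le> \<tau>" "\<tau> * t \<le> 1"
    and fit: "(1 - \<tau> * t) * (x + (L + t) / sqrt (1 + t\<^sup>2)) \<le> W + \<tau> * \<beta>"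
  shows "packable {z. x \<le> z $ 1 \<and> \<beta> + t * z $ 1 \<le> z $ 2 \<and>
    z $ 2 \<le> \<beta> + k * sqrt (1 + t\<^sup>2) + t * z $ 1 \<and> z $ 1 \<le> W + \<tau> * z $ 2} (k * L)"
proof -
  define c where "c = sqrt (1 + t\<^sup>2)"
  have c: "c > 0" "c * c = 1 + t\<^sup>2" unfolding c_def by (rule sqrt_one_plus_square)+
  let ?R = "\<lambda>k :: nat. {z :: plane. x \<le> z $ 1 \<and> \<beta> + t * z $ 1 \<le> z $ 2 \<and>
    z $ 2 \<le> \<beta> + k * c + t * z $ 1 \<and> z $ 1 \<le> W + \<tau> * z $ 2}"
  have "packable (?R k) (k * L)"
  proof (induction k)
    case 0
    then show ?case by (simp add: packable_0)
  next
    case (Suc k)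
    define y where "y = \<beta> + k * c"
    \<comment> \<open>The upper left corner of a rod lies \<open>t / c\<close> to the left of its
      lower left corner, which is therefore placed at \<open>x + t / c\<close>.\<close>
    let ?Q = "rod t (x + t / c) (y + t * (x + t / c)) 0 (real L)"
    have Q: "x \<le> z $ 1" "y + t * z $ 1 \<le> z $ 2" "z $ 2 \<le> y + c + t * z $ 1" "z $ 1 \<le> W + \<tau> * z $ 2"
      if z: "z \<in> ?Q" for z
    proof -
      obtain a b where ab: "0 \<le> a" "a \<le> real L" "0 \<le> b" "b \<le> 1"
        "z $ 1 = x + t / c + (a - t * b) / c" "z $ 2 = y + t * (x + t / c) + (t * a + b) / c"
        using rodE[OF z c_def] by blast
      have "t * b \<le> t" using ab t by (simp add: mult_left_le)
      then have "0 \<le> (a + t - t * b) / c" using ab c(1) by simp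
      then show "x \<le> z $ 1" unfolding ab by (simp add: add_divide_distrib diff_divide_distrib)
      have "z $ 2 - t * z $ 1 - y = b * (1 + t\<^sup>2) / c"
        unfolding ab by (simp add: add_divide_distrib diff_divide_distrib algebra_simps power2_eq_square)
      also have "\<dots> = b * c" using c by (simp add: field_simps flip: c(2))
      finally have eq: "z $ 2 - t * z $ 1 - y = b * c" .
      have "0 \<le> b * c" "b * c \<le> c" using ab c(1) by (auto simp: mult_left_le_one_le)
      then show "y + t * z $ 1 \<le> z $ 2" "z $ 2 \<le> y + c + t * z $ 1" using eq by linarith+
      \<comment> \<open>On the rod this quantity is largest at the lower right corner, where
        \<open>a = L\<close> and \<open>b = 0\<close>.\<close>
      have "z $ 1 - \<tau> * z $ 2 = (1 - \<tau> * t) * (x + t / c) - \<tau> * y + a * (1 - \<tau> * t) / c - b * (t + \<tau>) / c"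
        unfolding ab by (simp add: add_divide_distrib diff_divide_distrib algebra_simps)
      also have "\<dots> \<le> (1 - \<tau> * t) * (x + t / c) - \<tau> * y + L * (1 - \<tau> * t) / c"
      proof -
        have "a * (1 - \<tau> * t) / c \<le> L * (1 - \<tau> * t) / c"
          using ab \<tau> c(1) by (intro divide_right_mono mult_right_mono) auto
        moreover have "0 \<le> b * (t + \<tau>) / c" using ab t \<tau> c(1) by auto
        ultimately show ?thesis by linarith
      qed
      also have "\<dots> = (1 - \<tau> * t) * (x + (L + t) / c) - \<tau> * y"
        by (simp add: add_divide_distrib diff_divide_distrib algebra_simps)
      also have "\<dots> \<le> W + \<tau> * \<beta> - \<tau> * y" using fit by (simp add: c_def)
      also have "\<dots> \<le> W" using \<tau>(1) c(1) by (simp add: y_def algebra_simps)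
      finally show "z $ 1 \<le> W + \<tau> * z $ 2" by simp
    qed
    have ky: "y + c = \<beta> + real (Suc k) * c" by (simp add: y_def algebra_simps)
    have kc: "0 \<le> k * c" using c(1) by simp
    have "packable (?R (Suc k)) (k * L + L)"
    proof (rule packable_Un_line[OF Suc packable_rod, where \<alpha> = "- t" and \<beta> = 1 and \<gamma> = y])
      show "?R k \<subseteq> ?R (Suc k)" using c(1) by (auto simp: algebra_simps)
      show "?Q \<subseteq> ?R (Suc k)"
      proof
        fix z assume z: "z \<in> ?Q"
        show "z \<in> ?R (Suc k)"
using Q[OF z] ky kc y_def by (intro CollectI conjI; linarith)
      qed
    qed (use Q in \<open>force simp: y_def\<close>)+
    then show ?case by (simp add: add.commute)
  qed
  then show ?thesis by (simp add: c_def)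
qed

text \<open>The induction peels off \<open>k\<close> rods of length \<open>L\<close> and the columns above the ledge of width \<open>s\<close> that
  arises when the remaining rods are shortened by \<open>s\<close>. By \<open>slope_eq\<close> the equation for the upper
  line is inherited by the rest, which starts at \<open>X + s\<close>.\<close>

lemma packable_tilted_layer:
  fixes t t' \<tau> \<beta> \<gamma> X W :: real and s k N L :: nat
  assumes t: "0 \<le> t" "t \<le> t'" and \<tau>: "0 \<le> \<tau>" "\<tau> * t \<le> 1"
    and slope_eq: "(t' - t) * s = k * (sqrt (1 + t\<^sup>2) - 1)"
    and step: "s * (1 - 1 / sqrt (1 + t\<^sup>2)) \<le> \<tau> * k"
    and "0 \<le> X" "s * N \<le> L"
    and "\<gamma> + t' * X = \<beta> + t * X + k * N + k * (sqrt (1 + t\<^sup>2) - 1) + t"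
    and "X + (L + t) / sqrt (1 + t\<^sup>2) \<le> W + \<tau> * \<beta>"
  shows "packable {z. X \<le> z $ 1 \<and> \<beta> + t * z $ 1 \<le> z $ 2 \<and> z $ 2 \<le> \<gamma> + t' * z $ 1 \<and>
    z $ 1 \<le> W + \<tau> * z $ 2} (k * N * L)"
  using assms(7-)
proof (induction N arbitrary: X \<beta> L)
  case 0
  then show ?case by (simp add: packable_0)
next
  case (Suc N)
  define c where "c = sqrt (1 + t\<^sup>2)"
  have c: "c \<ge> 1" using sqrt_one_plus_square[of t] by (simp add: c_def)
  note prems = Suc.prems[folded c_def]
  note slope_eq = slope_eq[folded c_def] and step = step[folded c_def]
  let ?R = "{z :: plane. X \<le> z $ 1 \<and> \<beta> + t * z $ 1 \<le> z $ 2 \<and> z $ 2 \<le> \<gamma> + t' * z $ 1 \<and>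
    z $ 1 \<le> W + \<tau> * z $ 2}"
  let ?A = "{z :: plane. X \<le> z $ 1 \<and> \<beta> + k * c + t * z $ 1 \<le> z $ 2 \<and> z $ 2 \<le> \<gamma> + t' * z $ 1 \<and>
    z $ 1 \<le> W + \<tau> * z $ 2}"
  have L: "s * N + s \<le> L" using prems(2) by (simp add: algebra_simps)
  have Lr: "real (L - s) = real L - s" using L by (simp add: of_nat_diff)
  have kc: "0 \<le> k * (c - 1)" using c by simp
  \<comment> \<open>Starting \<open>s\<close> further right with \<open>s\<close> squares fewer
    moves the end of a rod right by \<open>s * (1 - 1 / c)\<close>. By \<open>step\<close> the wall
    recedes at least as much over \<open>k\<close> rods.\<close>
  have fit': "X + s + (real (L - s) + t) / c \<le> W + \<tau> * (\<beta> + k * c)"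
  proof -
    have "X + s + (real (L - s) + t) / c = X + (L + t) / c + s * (1 - 1 / c)"
      unfolding Lr by (simp add: add_divide_distrib diff_divide_distrib algebra_simps)
    also have "\<dots> \<le> W + \<tau> * \<beta> + \<tau> * k" using prems(4) step by linarith
    also have "\<dots> \<le> W + \<tau> * (\<beta> + k * c)"
      using mult_left_mono[OF c, of "\<tau> * k"] \<tau> by (simp add: algebra_simps)
    finally show ?thesis .
  qed
  \<comment> \<open>Between \<open>X\<close> and \<open>X + s\<close> the two lines diverge by
    \<open>(t' - t) * s\<close>, which by \<open>slope_eq\<close> restores exactly the excess
    thickness \<open>k * (c - 1)\<close> used up by the batch.\<close>
  have next_line: "\<gamma> + t' * (X + s) = \<beta> + k * c + t * (X + s) + k * N + k * (c - 1) + t"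
    using prems(3) slope_eq by (simp add: algebra_simps)
  \<comment> \<open>Columns of integer height \<open>k * N\<close> fit: the remaining
    \<open>t\<close> is the rise of the ledge across one column.\<close>
  have gap: "\<gamma> + t' * X = \<beta> + k * c + t * X + k * N + t"
    using prems(3) by (simp add: algebra_simps)
  have rest: "packable {z. X + s \<le> z $ 1 \<and> \<beta> + k * c + t * z $ 1 \<le> z $ 2 \<and> z $ 2 \<le> \<gamma> + t' * z $ 1 \<and>
    z $ 1 \<le> W + \<tau> * z $ 2} (k * N * (L - s))"
    by (rule Suc.IH) (use prems(1) L fit' next_line in \<open>auto simp: c_def\<close>)
  have cols: "packable {z. X \<le> z $ 1 \<and> z $ 1 \<le> X + s \<and> \<beta> + k * c + t * z $ 1 \<le> z $ 2 \<and>
    z $ 2 \<le> \<gamma> + t' * z $ 1 \<and> z $ 1 \<le> W + \<tau> * z $ 2} (\<Sum>i<s. k * N)"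
  proof (rule packable_columns)
    fix i assume i: "i < s"
    have "\<beta> + k * c + t * (X + i + 1) + real (k * N) \<le> \<gamma> + t' * (X + i)"
      using gap mult_right_mono[OF t(2), of "real i"] by (simp add: algebra_simps)
    moreover have "X + i + 1 \<le> W + \<tau> * (\<beta> + k * c + t * (X + i + 1))"
    proof -
      have "X + i + 1 \<le> X + s + (real (L - s) + t) / c"
        using i t c by (simp add: add_increasing2)
      moreover have "0 \<le> \<tau> * (t * (X + i + 1))" using \<tau> t prems(1) by simp
      ultimately show ?thesis using fit' by (simp add: algebra_simps)
    qed
    ultimately show "k * N = 0 \<or> \<beta> + k * c + t * (X + i + 1) + real (k * N) \<le> \<gamma> + t' * (X + i) \<and>
      X + i + 1 \<le> W + \<tau> * (\<beta> + k * c + t * (X + i + 1))" by blast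
  qed (use t \<tau> in auto)
  have A: "packable ?A (s * (k * N) + k * N * (L - s))"
    using packable_Un_line[OF cols rest, of ?A 1 0 "X + s"] by force
  have above: "\<beta> + k * c + t * x \<le> \<gamma> + t' * x" if "X \<le> x" for x
  proof -
    have "0 \<le> (t' - t) * (x - X)" using that t by simp
    moreover have "0 \<le> real k * real N" by simp
    moreover have "\<gamma> + t' * x = \<beta> + k * c + t * x + k * N + t + (t' - t) * (x - X)"
      using gap by (simp add: algebra_simps)
    ultimately show ?thesis using t(1) by linarith
  qed
  have "(1 - \<tau> * t) * (X + (L + t) / c) \<le> X + (L + t) / c"
    using \<tau> t c prems(1) by (intro mult_left_le_one_le) auto
  then have batch: "packable {z. X \<le> z $ 1 \<and> \<beta> + t * z $ 1 \<le> z $ 2 \<and>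
    z $ 2 \<le> \<beta> + k * c + t * z $ 1 \<and> z $ 1 \<le> W + \<tau> * z $ 2} (k * L)"
    unfolding c_def using t \<tau> prems(4)[unfolded c_def] by (intro packable_batch) auto
  have kc: "0 \<le> k * c" using c by simp
  have "packable ?R (k * L + (s * (k * N) + k * N * (L - s)))"
  proof (rule packable_Un_line[OF batch A, where \<alpha> = "- t" and \<beta> = 1 and \<gamma> = "\<beta> + k * c"])
    show "{z. X \<le> z $ 1 \<and> \<beta> + t * z $ 1 \<le> z $ 2 \<and>
      z $ 2 \<le> \<beta> + k * c + t * z $ 1 \<and> z $ 1 \<le> W + \<tau> * z $ 2} \<subseteq> ?R"
      using above by (auto intro: order_trans)
    show "?A \<subseteq> ?R"
      using kc by (intro Collect_mono impI conjI; linarith)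
  qed auto
  \<comment> \<open>The \<open>s\<close> columns of height \<open>k * N\<close> regain exactly what
    the shortening of the remaining \<open>k * N\<close> rods by \<open>s\<close> takes
    away.\<close>
  moreover have "k * L + (s * (k * N) + k * N * (L - s)) = k * Suc N * L"
  proof -
    have "k * N * (L - s) + k * N * s = k * N * L" using L by (simp flip: add_mult_distrib2)
    then show ?thesis by (simp add: algebra_simps)
  qed
  ultimately show ?case by simp
qed

section \<open>Real lower bounds for packing numbers\<close>

text \<open>A real bound \<open>r\<close> lets areas and error terms be added without rounding;
  negative \<open>r\<close> are allowed.\<close>

definition packs :: "plane set \<Rightarrow> real \<Rightarrow> bool" where
  "packs S r \<longleftrightarrow> (\<exists>n. packable S n \<and> r \<le> real n)"

lemma packs_of_packable: "packable S n \<Longrightarrow> r \<le> real n \<Longrightarrow> packs S r"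
  unfolding packs_def by blast

lemma packs_mono: "packs S r \<Longrightarrow> S \<subseteq> T \<Longrightarrow> r' \<le> r \<Longrightarrow> packs T r'"
  unfolding packs_def by (meson packable_mono order_trans)

lemma packs_Un_line:
  assumes "packs A r" "packs B r'" "A \<subseteq> S" "B \<subseteq> S"
    and "\<And>z. z \<in> A \<Longrightarrow> \<alpha> * z $ 1 + \<beta> * z $ 2 \<le> \<gamma>"
    and "\<And>z. z \<in> B \<Longrightarrow> \<gamma> \<le> \<alpha> * z $ 1 + \<beta> * z $ 2" and "\<alpha> \<noteq> 0 \<or> \<beta> \<noteq> 0"
  shows "packs S (r + r')"
proof -
  obtain m n where mn: "packable A m" "packable B n" "r \<le> real m" "r' \<le> real n"
    using assms(1,2) unfolding packs_def by blast
  have "packable S (m + n)" by (rule packable_Un_line[OF mn(1,2) assms(3-7)])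
  then show ?thesis using mn by (auto simp: packs_def intro!: exI[of _ "m + n"])
qed

subsection \<open>Parameters of the layers\<close>

text \<open>The horizontal extent that a rod of slope \<open>t\<close> loses per square:
  \<open>L\<close> squares span \<open>L / sqrt (1 + t\<^sup>2)\<close>.\<close>

definition contraction :: "real \<Rightarrow> real" where "contraction t = 1 - 1 / sqrt (1 + t\<^sup>2)"

context
  fixes q :: nat
  assumes q: "100 \<le> q"
begin

text \<open>The largest integer \<open>s\<close> for which \<open>s * contraction t\<close> is at
  most \<open>1 / q\<close>, the recession of a wall of slope \<open>1 / q\<^sup>2\<close> over
  \<open>q\<close> units of height.\<close>

definition ledge_width :: "real \<Rightarrow> nat" where "ledge_width t = nat \<lfloor>1 / (q * contraction t)\<rfloor>"
text \<open>The term \<open>20 / q\<close> absorbs the fluctuation of the wall around its ideal position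
  (lemma \<open>gap_bounds\<close> below) and the end loss of the tilted rods.\<close>

definition rod_length :: "real \<Rightarrow> nat" where "rod_length t = nat \<lceil>(1 + 20 / q) / contraction t\<rceil>"

lemma tilt_bounds:
  assumes t: "1 / (2 * real q) \<le> t" "t \<le> 1 / q"
  defines "c \<equiv> sqrt (1 + t\<^sup>2)"
  shows "0 < t" "1 \<le> c" "c - 1 \<le> t\<^sup>2 / 2" "c - 1 \<le> 1 / (2 * real q ^ 2)" "contraction t = (c - 1) / c"
    "contraction t \<le> t\<^sup>2 / 2" "contraction t \<le> 1 / (2 * real q ^ 2)" "1 / (16 * real q ^ 2) \<le> contraction t" "0 < contraction t"
    "t\<^sup>2 \<le> 1 / real q ^ 2"
proof -
  have q0: "real q \<ge> 100" using q by simp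
  have "0 < 1 / (2 * real q)" using q0 by simp
  then show t0: "0 < t" using t(1) by linarith
  show c1: "1 \<le> c" by (simp add: c_def)
  have cc: "c * c = 1 + t\<^sup>2" unfolding c_def by (rule sqrt_one_plus_square)
  show "c - 1 \<le> t\<^sup>2 / 2"
  proof -
    have "0 \<le> (c - 1)\<^sup>2" by simp
    then show ?thesis using cc by (simp add: power2_eq_square algebra_simps)
  qed
  have "t\<^sup>2 \<le> (1 / q)\<^sup>2" using t t0 by (intro power_mono) auto
  then show tq: "t\<^sup>2 \<le> 1 / real q ^ 2" by (simp add: power_divide)
  then show c2: "c - 1 \<le> 1 / (2 * real q ^ 2)" using \<open>c - 1 \<le> t\<^sup>2 / 2\<close> by simp
  show z: "contraction t = (c - 1) / c" using c1 unfolding contraction_def c_def[symmetric] by (simp add: diff_divide_distrib)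
  have "(c - 1) / c \<le> c - 1" using c1 by (simp add: divide_le_eq mult_left_mono mult_le_cancel_left1)
  then have "contraction t \<le> c - 1" unfolding z .
  then show "contraction t \<le> t\<^sup>2 / 2" "contraction t \<le> 1 / (2 * real q ^ 2)" using c2 \<open>c - 1 \<le> t\<^sup>2 / 2\<close> by linarith+
  have "1 / (2 * real q ^ 2) \<le> 1 / 2" using q0 by (simp add: divide_le_eq)
  then have c3: "c \<le> 3 / 2" using c2 by linarith
  \<comment> \<open>The lower bound follows because the denominator is at most 15/4 for
    \<open>c \<le> 3 / 2\<close>, while \<open>t\<^sup>2\<close> is at least
    \<open>1 / (4 * q\<^sup>2)\<close>.\<close>
  have "contraction t = t\<^sup>2 / (c * (c + 1))"
  proof -
    have "(c - 1) * (c + 1) = t\<^sup>2" using cc by (simp add: algebra_simps)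
    moreover have "(c - 1) / c = ((c - 1) * (c + 1)) / (c * (c + 1))" using c1 by simp
    ultimately show ?thesis using z by simp
  qed
  moreover have "c * (c + 1) \<le> (3/2) * (3/2 + 1)" using c1 c3 by (intro mult_mono) auto
  then have "t\<^sup>2 / 4 \<le> t\<^sup>2 / (c * (c + 1))"
    using c1 by (intro divide_left_mono) auto
  ultimately have "t\<^sup>2 / 4 \<le> contraction t" by simp
  moreover have "(1 / (2 * real q))\<^sup>2 \<le> t\<^sup>2" using t q0 by (intro power_mono) auto
  ultimately have z16: "1 / (16 * real q ^ 2) \<le> contraction t" by (simp add: power_divide power_mult_distrib)
  then show "1 / (16 * real q ^ 2) \<le> contraction t" .
  have "0 < 1 / (16 * real q ^ 2)" using q0 by simp
  then show "0 < contraction t" using z16 by linarith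
qed

lemma ledge_bounds:
  assumes t: "1 / (2 * real q) \<le> t" "t \<le> 1 / q"
  shows "ledge_width t * contraction t \<le> 1 / q" "1 / (q * contraction t) - 1 \<le> ledge_width t" "1 / (2 * q * contraction t) \<le> ledge_width t" "0 < ledge_width t"
    "ledge_width t * q \<le> rod_length t" "1 + 20 / q \<le> rod_length t * contraction t" "rod_length t * contraction t \<le> 1 + 20 / q + contraction t"
    "rod_length t \<le> 20 * real q ^ 2" "2 \<le> rod_length t"
proof -
  note b = tilt_bounds[OF t]
  have q0: "real q \<ge> 100" using q by simp
  define u where "u = 1 / (q * contraction t)"
  have u: "u \<ge> 2 * real q"
  proof -
    have "q * contraction t \<le> q * (1 / (2 * real q ^ 2))" using b(7) by (intro mult_left_mono) auto
    also have "\<dots> = 1 / (2 * real q)" using q0 by (simp add: power2_eq_square)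
    finally have "2 * q * (q * contraction t) \<le> 1" using q0 by (simp add: field_simps)
    then show ?thesis using b(9) q0 by (simp add: u_def field_simps)
  qed
  have st: "real (ledge_width t) \<le> u" "u - 1 \<le> ledge_width t"
    unfolding ledge_width_def u_def[symmetric] using u q0 by linarith+
  show "1 / (q * contraction t) - 1 \<le> ledge_width t" using st unfolding u_def by simp
  have "u / 2 \<le> ledge_width t" using st u q0 by linarith
  then show "1 / (2 * q * contraction t) \<le> ledge_width t" by (simp add: u_def)
  show "0 < ledge_width t" using st u q0 by linarith
  have "ledge_width t * contraction t \<le> u * contraction t" using st b(9) by (intro mult_right_mono) auto
  also have "\<dots> = 1 / q" using b(9) by (simp add: u_def)
  finally show "ledge_width t * contraction t \<le> 1 / q" .
  have "real (ledge_width t) * q \<le> u * q" using st by (intro mult_right_mono) auto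
  also have "\<dots> = 1 / contraction t" using q0 by (simp add: u_def)
  finally have sq: "real (ledge_width t * q) \<le> 1 / contraction t" by simp
  let ?l = "(1 + 20 / q) / contraction t"
  have l1: "1 / contraction t \<le> ?l" using b(9) by (intro divide_right_mono) auto
  have pos: "0 < ?l" using b(9) q0 by (simp add: add_pos_nonneg)
  have rl: "?l \<le> rod_length t" "rod_length t \<le> ?l + 1"
    unfolding rod_length_def using pos by linarith+
  have "real (ledge_width t * q) \<le> rod_length t" using sq l1 rl by linarith
  then show "ledge_width t * q \<le> rod_length t" by linarith
  have "?l * contraction t = 1 + 20 / q" using b(9) by simp
  then show "1 + 20 / q \<le> rod_length t * contraction t" "rod_length t * contraction t \<le> 1 + 20 / q + contraction t"
    using mult_right_mono[OF rl(1), of "contraction t"] mult_right_mono[OF rl(2), of "contraction t"] b(9)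
    by (auto simp: algebra_simps)
  \<comment> \<open>With \<open>contraction t\<close> at least \<open>1 / (16 * q\<^sup>2)\<close>
    the quotient is at most \<open>19.2 * q\<^sup>2\<close>; this is the source of the constant
    20.\<close>
  have "1 + 20 / q \<le> 6 / 5" using q0 by (simp add: field_simps)
  then have "?l \<le> (6 / 5) / (1 / (16 * real q ^ 2))"
    using b(8,9) q0 by (intro frac_le) auto
  also have "\<dots> \<le> 20 * real q ^ 2 - 1"
  proof -
    have "100 * 100 \<le> real q * real q" using q0 by (intro mult_mono) auto
    then have "2 \<le> real q ^ 2" by (simp add: power2_eq_square)
    then show ?thesis by simp
  qed
  finally show "rod_length t \<le> 20 * real q ^ 2" using rl by simp
  have "1 * 2 \<le> ledge_width t * q" using q \<open>0 < ledge_width t\<close> by (intro mult_le_mono) auto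
  then show "2 \<le> rod_length t" using \<open>ledge_width t * q \<le> rod_length t\<close> by linarith
qed

text \<open>The recursion is \<open>slope_eq\<close> of \<open>packable_tilted_layer\<close> with
  \<open>k = q\<close>, solved for \<open>t'\<close>.\<close>

fun tilt :: "nat \<Rightarrow> real" where
  "tilt 0 = 1 / (2 * real q)"
| "tilt (Suc p) = tilt p + q * (sqrt (1 + (tilt p)\<^sup>2) - 1) / ledge_width (tilt p)"

lemma tilt_step:
  assumes t: "1 / (2 * real q) \<le> t" "t \<le> 1 / q"
  shows "0 \<le> q * (sqrt (1 + t\<^sup>2) - 1) / ledge_width t" "q * (sqrt (1 + t\<^sup>2) - 1) / ledge_width t \<le> 1 / (2 * real q ^ 2)"
proof -
  note b = tilt_bounds[OF t] and s = ledge_bounds[OF t]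
  have q0: "real q \<ge> 100" using q by simp
  show "0 \<le> q * (sqrt (1 + t\<^sup>2) - 1) / ledge_width t" using b(2) by simp
  have "q * (sqrt (1 + t\<^sup>2) - 1) / ledge_width t \<le> q * (t\<^sup>2 / 2) / (1 / (2 * q * contraction t))"
    using s(3) b(2,3,9) q0 by (intro frac_le mult_left_mono mult_nonneg_nonneg) (auto simp del: One_nat_def)
  also have "\<dots> = real q ^ 2 * t\<^sup>2 * contraction t" by (simp add: power2_eq_square)
  also have "\<dots> \<le> real q ^ 2 * (1 / real q ^ 2) * (1 / (2 * real q ^ 2))"
    using b by (intro mult_mono) auto
  also have "\<dots> = 1 / (2 * real q ^ 2)" using q0 by simp
  finally show "q * (sqrt (1 + t\<^sup>2) - 1) / ledge_width t \<le> 1 / (2 * real q ^ 2)" .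
qed

text \<open>Each of at most \<open>q\<close> steps adds at most \<open>1 / (2 * q\<^sup>2)\<close>.
  The induction carries the explicit linear bound, since \<open>tilt_step\<close> needs the slope to
  be in range already.\<close>

lemma tilt_range:
  assumes "p \<le> q"
  shows "1 / (2 * real q) \<le> tilt p" "tilt p \<le> 1 / q"
proof -
  have q0: "real q \<ge> 100" using q by simp
  have small: "1 / (2 * real q) + p / (2 * real q ^ 2) \<le> 1 / q" if "p \<le> q" for p
  proof -
    have "p / (2 * real q ^ 2) \<le> q / (2 * real q ^ 2)" using that by (intro divide_right_mono) auto
    also have "\<dots> = 1 / (2 * real q)" using q0 by (simp add: power2_eq_square)
    finally show ?thesis by simp
  qed
  have "1 / (2 * real q) \<le> tilt p \<and> tilt p \<le> 1 / (2 * real q) + p / (2 * real q ^ 2)" using assms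
  proof (induction p)
    case 0
    then show ?case by simp
  next
    case (Suc p)
    then have IH: "1 / (2 * real q) \<le> tilt p" "tilt p \<le> 1 / (2 * real q) + p / (2 * real q ^ 2)" by auto
    then have "tilt p \<le> 1 / q" using small[of p] Suc by linarith
    note step = tilt_step[OF IH(1) this]
    have "real (Suc p) / (2 * real q ^ 2) = p / (2 * real q ^ 2) + 1 / (2 * real q ^ 2)"
      by (simp add: add_divide_distrib)
    then show ?case using IH step unfolding tilt.simps by linarith
  qed
  then show "1 / (2 * real q) \<le> tilt p" "tilt p \<le> 1 / q" using small[OF assms] by linarith+
qed

lemma tilt_mono: "p < q \<Longrightarrow> tilt p \<le> tilt (Suc p) \<and> tilt (Suc p) - tilt p \<le> 1 / (2 * real q ^ 2)"
  using tilt_step[OF tilt_range[of p]] by simp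

text \<open>Steeper rods contract more, so fewer squares suffice for the same total contraction.
  This makes the left ends of successive layers move to the right.\<close>

lemma rod_length_antimono:
  assumes "p < q"
  shows "rod_length (tilt (Suc p)) \<le> rod_length (tilt p)"
proof -
  have t: "tilt p \<le> tilt (Suc p)" "0 < tilt p"
    using tilt_mono[OF assms] tilt_bounds(1)[OF tilt_range[of p]] assms by auto
  then have "(tilt p)\<^sup>2 \<le> (tilt (Suc p))\<^sup>2" by (intro power_mono) auto
  then have "contraction (tilt p) \<le> contraction (tilt (Suc p))"
    unfolding contraction_def by (simp add: frac_le add_pos_nonneg)
  moreover have "0 < contraction (tilt p)" using tilt_bounds(9)[OF tilt_range[of p]] assms by simp
  ultimately have "(1 + 20 / q) / contraction (tilt (Suc p)) \<le> (1 + 20 / q) / contraction (tilt p)"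
    by (intro divide_left_mono) auto
  then show ?thesis unfolding rod_length_def by (intro nat_mono ceiling_mono)
qed

end

section \<open>Area balance of one layer\<close>

text \<open>The factor in front of the square is the slope increment \<open>\<delta>\<close>, about
  \<open>(q * contraction t)\<^sup>2\<close>, and \<open>L * contraction t\<close> is about 1. So a
  layer gains area \<open>\<delta> * L\<^sup>2 / 2\<close>, about \<open>q\<^sup>2 / 2\<close>, by
  opening from one slope to the next. The leading constant must be exact, because this gain has to
  match the triangle of area about \<open>q\<^sup>2 / 2\<close> that the wall cuts off at the right
  end.\<close>

lemma tooth_area_bound:
  assumes q: "100 \<le> q" and t: "1 / (2 * real q) \<le> t" "t \<le> 1 / q"
  shows "q * (sqrt (1 + t\<^sup>2) - 1) / ledge_width q t * (real (rod_length q t))\<^sup>2 \<le> real q ^ 2 + 100 * q"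
proof -
  define c where "c = sqrt (1 + t\<^sup>2)"
  define L where "L = real (rod_length q t)"
  define s where "s = real (ledge_width q t)"
  note b = tilt_bounds[OF q t, folded c_def] and sb = ledge_bounds[OF q t, folded L_def s_def]
  define \<delta> where "\<delta> = q * (c - 1) / s"
  define y where "y = 1 / real q"
  have q0: "real q \<ge> 100" using q by simp
  have y: "0 < y" "y \<le> 1 / 100" "q * y = 1" using q0 by (auto simp: y_def field_simps)
  have z: "0 < contraction t" "q * contraction t \<le> y / 2" "contraction t \<le> y"
  proof -
    show "0 < contraction t" by (rule b)
    have "q * contraction t \<le> q * (1 / (2 * real q ^ 2))" using b(7) by (intro mult_left_mono) auto
    also have "\<dots> = y / 2" using q0 by (simp add: y_def power2_eq_square)
    finally show *: "q * contraction t \<le> y / 2" .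
    have "1 * contraction t \<le> q * contraction t" using q0 b(9) by (intro mult_right_mono) auto
    then show "contraction t \<le> y" using * y by linarith
  qed
  have \<delta>0: "0 \<le> \<delta>" using b(2) by (simp add: \<delta>_def s_def)
  \<comment> \<open>The floor in \<open>ledge_width\<close> costs the factor
    \<open>1 - q * contraction t\<close>, which is kept on the left and cancelled at the
    end.\<close>
  have "\<delta> * (1 - q * contraction t) \<le> \<delta> * (s * (q * contraction t))"
  proof (rule mult_left_mono[OF _ \<delta>0])
    have "(1 / (q * contraction t) - 1) * (q * contraction t) \<le> s * (q * contraction t)"
      using sb(2) z(1) by (intro mult_right_mono) auto
    moreover have "(1 / (q * contraction t) - 1) * (q * contraction t) = 1 - q * contraction t"
      using z(1) q0 by (simp add: left_diff_distrib)
    ultimately show "1 - q * contraction t \<le> s * (q * contraction t)" by simp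
  qed
  also have "\<dots> = q * (c - 1) * (q * contraction t)" using sb(4) by (simp add: \<delta>_def s_def)
  also have "\<dots> = real q ^ 2 * c * (contraction t)\<^sup>2"
    using b(2,5) by (simp add: power2_eq_square)
  finally have 1: "\<delta> * (1 - q * contraction t) \<le> real q ^ 2 * c * (contraction t)\<^sup>2" .
  have "\<delta> * L\<^sup>2 * (1 - q * contraction t) \<le> real q ^ 2 * c * (L * contraction t)\<^sup>2"
    using mult_right_mono[OF 1, of "L\<^sup>2"] by (simp add: power_mult_distrib mult.commute mult.left_commute)
  also have "\<dots> \<le> real q ^ 2 * (1 + y) * (1 + 21 * y)\<^sup>2"
  proof (intro mult_mono power_mono order_refl)
    have "1 * (1 / real q) \<le> real q * (1 / real q)" using q0 by (intro mult_right_mono) auto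
    then have "1 / (2 * real q ^ 2) \<le> y" using q0 by (simp add: y_def field_simps power2_eq_square)
    then show "c \<le> 1 + y" using b(4) by linarith
    have "20 / real q = 20 * y" by (simp add: y_def)
    then show "L * contraction t \<le> 1 + 21 * y" using sb(7) z(3) by linarith
    show "0 \<le> L * contraction t" using z(1) by (simp add: L_def)
  qed (use y b(2) in auto)
  also have "\<dots> \<le> real q ^ 2 * ((1 + 100 * y) * (1 - y / 2))"
  proof -
    \<comment> \<open>After expansion, \<open>1 + 43 * y + ...\<close> is compared with
      \<open>1 + 99.5 * y - 50 * y\<^sup>2\<close>; the linear terms leave enough room for the
      rest.\<close>
    have "y * (533 * y + 441 * y\<^sup>2) \<le> y * 56"
    proof (rule mult_left_mono)
      have "y\<^sup>2 \<le> (1 / 100)\<^sup>2" using y by (intro power_mono) auto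
      then show "533 * y + 441 * y\<^sup>2 \<le> 56" using y by (simp add: power2_eq_square)
    qed (use y in auto)
    then have "(1 + y) * (1 + 21 * y)\<^sup>2 \<le> (1 + 100 * y) * (1 - y / 2)"
      using y by (simp add: power2_eq_square algebra_simps)
    then show ?thesis using mult_left_mono[of _ _ "real q ^ 2"] by (simp add: mult.assoc)
  qed
  also have "\<dots> \<le> real q ^ 2 * ((1 + 100 * y) * (1 - q * contraction t))"
    using z y by (intro mult_left_mono) auto
  finally have "\<delta> * L\<^sup>2 * (1 - q * contraction t) \<le> (real q ^ 2 * (1 + 100 * y)) * (1 - q * contraction t)"
    by (simp add: mult.assoc)
  then have "\<delta> * L\<^sup>2 \<le> real q ^ 2 * (1 + 100 * y)"
    by (rule mult_right_le_imp_le) (use z y in linarith)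
  also have "\<dots> = real q ^ 2 + 100 * q" using y(3) by (simp add: power2_eq_square algebra_simps)
  finally show ?thesis by (simp add: \<delta>_def L_def s_def c_def)
qed

text \<open>The area above the line \<open>y = \<beta> + t x\<close> and below \<open>y = H\<close> for \<open>X \<le> x \<le> S\<close>, together with the
  area that the wall \<open>x = W + y / Q\<close> leaves free to the right of \<open>S\<close>.\<close>

definition area_above :: "real \<Rightarrow> real \<Rightarrow> real \<Rightarrow> real \<Rightarrow> real \<Rightarrow> real \<Rightarrow> real \<Rightarrow> real" where
  "area_above Q W H X S \<beta> t = (S - X) * (H - \<beta>) - t * (S\<^sup>2 - X\<^sup>2) / 2 + Q * (W + H / Q - S)\<^sup>2 / 2"

text \<open>An exact balance for passing to the next layer. On the left, the squares of the layer,
  \<open>Q * (S - X)\<close>, and the lower bound for the columns over \<open>[X, X']\<close> are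
  subtracted from the loss of area; the right side is the waste. There the opening term
  \<open>(t' - t) * (S - X)\<^sup>2 / 2\<close> faces \<open>- Q / 2\<close>.\<close>

lemma area_above_step:
  fixes Q :: real
  assumes "Q \<noteq> 0" and \<beta>': "\<beta>' = \<beta> + Q + e - (t' - t) * X"
  shows "area_above Q W H X S \<beta> t - area_above Q W H X' (S + 1) \<beta>' t' - Q * (S - X)
      - ((X' - X) * (H - \<beta>' - 1) - t' * ((X' - X) * X + (X' - X) * (X' - X + 1) / 2))
    = (S - X) * e + (t' - t) * (S - X)\<^sup>2 / 2 + (X' - X) * (1 + t' / 2) + Q * (1 - (S + 1 - W - \<beta>' / Q))
      + t' * (S + 1 / 2) - Q / 2"
proof -
  define h where "h = H / Q"
  have H: "H = Q * h" using assms(1) by (simp add: h_def)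
  have "Q * (1 - (S + 1 - W - \<beta>' / Q)) = Q * (W - S) + \<beta>'"
    using assms(1) by (simp add: field_simps)
  note E = this
  show ?thesis
    unfolding E area_above_def h_def[symmetric] unfolding H
    by (simp add: \<beta>' field_simps power2_eq_square)
qed

lemma sum_floor_ge:
  fixes d :: nat and h t X :: real
  shows "(\<Sum>i<d. real (nat \<lfloor>h - t * (X + i + 1)\<rfloor>)) \<ge> d * (h - 1) - t * (d * X + d * (real d + 1) / 2)"
proof -
  have "(\<Sum>i<d. h - t * (X + i + 1) - 1) = d * (h - 1) - t * (d * X + d * (real d + 1) / 2)" for d :: nat
    by (induction d) (auto simp: field_simps)
  moreover have "(\<Sum>i<d. h - t * (X + i + 1) - 1) \<le> (\<Sum>i<d. real (nat \<lfloor>h - t * (X + i + 1)\<rfloor>))"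
    by (intro sum_mono) linarith
  ultimately show ?thesis by simp
qed

context
  fixes q :: nat
  assumes q: "100 \<le> q"
begin

subsection \<open>Blocks of \<open>q\<close> layers\<close>

text \<open>In layer \<open>p\<close> the first rod starts at \<open>left_end p\<close> and would end at \<open>reach p\<close> if it were
  horizontal; the wall is at distance about \<open>1\<close> to the left of \<open>reach p\<close>.\<close>

definition reach :: "nat \<Rightarrow> nat" where "reach p = rod_length q (tilt q 0) + p"
definition left_end :: "nat \<Rightarrow> nat" where "left_end p = reach p - rod_length q (tilt q p)"
definition block_width :: nat where "block_width = rod_length q (tilt q 0) - 1"

text \<open>The intercept at abscissa 0 of the line below layer \<open>p\<close>. The recursion is
  the equation for the upper line in \<open>packable_tilted_layer\<close> with
  \<open>k = N = q\<close> and \<open>X = left_end p\<close>, solved for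
  \<open>\<gamma>\<close>.\<close>

fun base_height :: "nat \<Rightarrow> real" where
  "base_height 0 = 0"
| "base_height (Suc p) = base_height p + real q ^ 2 + (q * (sqrt (1 + (tilt q p)\<^sup>2) - 1) + tilt q p)
     - (tilt q (Suc p) - tilt q p) * left_end p"

lemma rod_length_le_first: "p \<le> q \<Longrightarrow> rod_length q (tilt q p) \<le> rod_length q (tilt q 0)"
proof (induction p)
  case (Suc p)
  then show ?case using rod_length_antimono[OF q, of p] by simp
qed simp

lemma left_end_simps: "p \<le> q \<Longrightarrow> left_end p + rod_length q (tilt q p) = reach p" "left_end 0 = 0"
  "p < q \<Longrightarrow> left_end p \<le> left_end (Suc p)"
  using rod_length_le_first[of p] rod_length_antimono[OF q, of p] by (auto simp: left_end_def reach_def)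

lemma block_width_simps: "real block_width = real (rod_length q (tilt q 0)) - 1" "real block_width \<le> 20 * real q ^ 2"
  "reach p = block_width + 1 + p"
  using ledge_bounds(8,9)[OF q tilt_range[OF q, of 0]] by (auto simp: block_width_def reach_def)

lemma reach_le: "p \<le> q \<Longrightarrow> real (reach p) \<le> 21 * real q ^ 2"
proof -
  assume p: "p \<le> q"
  have "real (rod_length q (tilt q 0)) \<le> 20 * real q ^ 2"
    using ledge_bounds(8)[OF q tilt_range[OF q, of 0]] by simp
  moreover have "1 * real p \<le> real q * real q" using p q by (intro mult_mono) auto
  ultimately show ?thesis by (simp add: reach_def power2_eq_square)
qed

text \<open>A rise of \<open>q\<^sup>2\<close> lets the wall recede by 1, which is the growth of
  \<open>reach\<close>. The error comes from the slope change over at most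
  \<open>21 * q\<^sup>2\<close>, hence \<open>21 / 2\<close>, and from terms of order
  \<open>1 / q\<close>.\<close>

lemma base_height_step:
  assumes "p < q"
  shows "\<bar>base_height (Suc p) - base_height p - real q ^ 2\<bar> \<le> 11"
    "0 \<le> q * (sqrt (1 + (tilt q p)\<^sup>2) - 1) + tilt q p"
    "q * (sqrt (1 + (tilt q p)\<^sup>2) - 1) + tilt q p \<le> 3 / (2 * real q)"
proof -
  define e where "e = q * (sqrt (1 + (tilt q p)\<^sup>2) - 1) + tilt q p"
  have p: "p \<le> q" using assms by simp
  note b = tilt_bounds[OF q tilt_range[OF q p]]
  have q0: "real q \<ge> 100" using q by simp
  have "q * (sqrt (1 + (tilt q p)\<^sup>2) - 1) \<le> q * (1 / (2 * real q ^ 2))"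
    using b(4) by (intro mult_left_mono) auto
  also have "\<dots> = 1 / (2 * real q)" using q0 by (simp add: power2_eq_square)
  finally have 1: "q * (sqrt (1 + (tilt q p)\<^sup>2) - 1) \<le> 1 / (2 * real q)" .
  have 2: "0 \<le> q * (sqrt (1 + (tilt q p)\<^sup>2) - 1)" using b(2) by simp
  have "1 / (2 * real q) + 1 / real q = 3 / (2 * real q)" using q0 by (simp add: field_simps)
  then show e: "0 \<le> q * (sqrt (1 + (tilt q p)\<^sup>2) - 1) + tilt q p"
    "q * (sqrt (1 + (tilt q p)\<^sup>2) - 1) + tilt q p \<le> 3 / (2 * real q)"
    using 1 2 b(1) tilt_range(2)[OF q p] by linarith+
  have "3 / (2 * real q) \<le> 1" using q0 by simp
  moreover have "0 \<le> (tilt q (Suc p) - tilt q p) * left_end p"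
    using tilt_mono[OF q assms] by simp
  moreover have "(tilt q (Suc p) - tilt q p) * left_end p \<le> (1 / (2 * real q ^ 2)) * (21 * real q ^ 2)"
  proof (rule mult_mono)
    have "left_end p \<le> reach p" by (simp add: left_end_def)
    then show "real (left_end p) \<le> 21 * real q ^ 2" using reach_le[OF p] by linarith
  qed (use tilt_mono[OF q assms] in auto)
  moreover have "(1 / (2 * real q ^ 2)) * (21 * real q ^ 2) = 21 / 2" using q0 by simp
  ultimately show "\<bar>base_height (Suc p) - base_height p - real q ^ 2\<bar> \<le> 11"
    using e unfolding base_height.simps by linarith
qed

lemma base_height_bounds: "p \<le> q \<Longrightarrow> \<bar>base_height p - p * real q ^ 2\<bar> \<le> 11 * p"
proof (induction p)
  case (Suc p)
  then have "\<bar>base_height p - p * real q ^ 2\<bar> \<le> 11 * p" by simp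
  moreover have "\<bar>base_height (Suc p) - base_height p - real q ^ 2\<bar> \<le> 11" using base_height_step Suc by simp
  moreover have "real (Suc p) * real q ^ 2 = p * real q ^ 2 + real q ^ 2" by (simp add: algebra_simps)
  ultimately show ?case by simp
qed simp

text \<open>Over at most \<open>q\<close> layers the height errors add up to at most
  \<open>11 * q\<close>; the wall turns this into a horizontal error of
  \<open>11 / q\<close>.\<close>

lemma gap_bounds:
  assumes "p \<le> q"
  shows "\<bar>real (reach p) - block_width - base_height p / real q ^ 2 - 1\<bar> \<le> 11 / q"
proof -
  have q0: "real q \<ge> 100" using q by simp
  have "real (reach p) - block_width - base_height p / real q ^ 2 - 1 = - (base_height p - p * real q ^ 2) / real q ^ 2"
    using q0 block_width_simps(3)[of p] by (simp add: field_simps)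
  also have "\<bar>\<dots>\<bar> \<le> 11 * p / real q ^ 2"
    using base_height_bounds[OF assms] by (simp add: divide_right_mono)
  also have "\<dots> \<le> 11 * q / real q ^ 2" using assms by (intro divide_right_mono) auto
  also have "\<dots> = 11 / q" using q0 by (simp add: power2_eq_square)
  finally show ?thesis .
qed

text \<open>This is \<open>packable_tilted_layer\<close> with \<open>k = N = q\<close>,
  \<open>s\<close> the ledge width and \<open>\<tau> = 1 / q\<^sup>2\<close>.\<close>

lemma packable_layer:
  assumes p: "p < q"
  shows "packable {z. left_end p \<le> z $ 1 \<and> base_height p + tilt q p * z $ 1 \<le> z $ 2 \<and>
      z $ 2 \<le> base_height (Suc p) + tilt q (Suc p) * z $ 1 \<and> z $ 1 \<le> block_width + 1 / real q ^ 2 * z $ 2}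
    (q * q * rod_length q (tilt q p))"
proof (rule packable_tilted_layer)
  define t where "t = tilt q p"
  define c where "c = sqrt (1 + t\<^sup>2)"
  have q0: "real q \<ge> 100" using q by simp
  have p': "p \<le> q" using p by simp
  note tb = tilt_range[OF q p', folded t_def]
  note b = tilt_bounds[OF q tb, folded c_def] and s = ledge_bounds[OF q tb]
  show "0 \<le> tilt q p" using b(1) by (simp add: t_def)
  show "tilt q p \<le> tilt q (Suc p)" using tilt_mono[OF q p] by simp
  show "0 \<le> 1 / real q ^ 2" by simp
  have "1 / real q ^ 2 * tilt q p \<le> 1 * 1"
  proof (rule mult_mono)
    have "1 \<le> real q * real q" using mult_mono[of 1 "real q" 1 "real q"] q0 by simp
    then show "1 / real q ^ 2 \<le> 1" using q0 by (simp add: power2_eq_square)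
    have "1 / real q \<le> 1" using q0 by simp
    then show "tilt q p \<le> 1" using tb(2) by (simp add: t_def)
  qed (use b(1) in \<open>auto simp: t_def\<close>)
  then show "1 / real q ^ 2 * tilt q p \<le> 1" by simp
  show "(tilt q (Suc p) - tilt q p) * ledge_width q (tilt q p) = q * (sqrt (1 + (tilt q p)\<^sup>2) - 1)"
    using s(4) by (simp add: t_def tilt.simps[OF q])
  have "1 / real q = 1 / real q ^ 2 * q" using q0 by (simp add: power2_eq_square)
  then show "ledge_width q (tilt q p) * (1 - 1 / sqrt (1 + (tilt q p)\<^sup>2)) \<le> 1 / real q ^ 2 * q"
    using s(1) by (simp add: contraction_def t_def)
  show "0 \<le> real (left_end p)" by simp
  show "ledge_width q (tilt q p) * q \<le> rod_length q (tilt q p)" using s(5) by (simp add: t_def)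
  show "base_height (Suc p) + tilt q (Suc p) * left_end p = base_height p + tilt q p * left_end p + q * q
      + q * (sqrt (1 + (tilt q p)\<^sup>2) - 1) + tilt q p"
    by (simp add: algebra_simps power2_eq_square)
  define L where "L = real (rod_length q t)"
  have "left_end p + (L + t) / c = reach p - (L * contraction t) + t / c"
  proof -
    have "L * contraction t = L - L / c" unfolding contraction_def c_def by (simp add: right_diff_distrib)
    moreover have "real (left_end p) + L = reach p"
      using left_end_simps(1)[OF p'] by (simp add: L_def t_def flip: of_nat_add)
    ultimately show ?thesis by (simp add: add_divide_distrib)
  qed
  also have "\<dots> \<le> reach p - (1 + 20 / q) + 1 / q"
  proof -
    have "t / c \<le> t" using b(1,2) by (simp add: divide_le_eq mult_le_cancel_left1)
    then show ?thesis using s(6) tb(2) by (simp add: L_def)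
  qed
  \<comment> \<open>The allowance \<open>20 / q\<close> in \<open>rod_length\<close> covers the end
    loss \<open>1 / q\<close> and the wall fluctuation \<open>11 / q\<close>.\<close>
  also have "\<dots> \<le> block_width + 1 / real q ^ 2 * base_height p"
  proof -
    have "20 / real q - 1 / real q \<ge> 11 / real q" using q0 by (simp add: field_simps)
    then show ?thesis using gap_bounds[OF p'] by simp
  qed
  finally show "real (left_end p) + (real (rod_length q (tilt q p)) + tilt q p) / sqrt (1 + (tilt q p)\<^sup>2)
      \<le> block_width + 1 / real q ^ 2 * base_height p"
    by (simp add: L_def c_def t_def)
qed

section \<open>Closing a block and counting its squares\<close>

text \<open>The \<open>q\<close> layers rise by about \<open>q\<^sup>3\<close>; the additional
  \<open>q\<^sup>2\<close> leaves room for their slanted tops. As a multiple of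
  \<open>q\<^sup>2\<close> it moves the wall by the integer \<open>q + 1\<close>.\<close>

definition block_height :: nat where "block_height = q ^ 2 * (q + 1)"

definition top_part :: "nat \<Rightarrow> plane set" where
  "top_part p = {z. left_end p \<le> z $ 1 \<and> base_height p + tilt q p * z $ 1 \<le> z $ 2 \<and> z $ 2 \<le> block_height \<and>
     z $ 1 \<le> block_width + 1 / real q ^ 2 * z $ 2}"

text \<open>The wall starts about 1 to the left of \<open>reach p\<close>, so this exceeds the area
  of \<open>top_part p\<close> by roughly \<open>q\<^sup>2 / 2\<close>, for every
  \<open>p\<close>.\<close>

definition top_area :: "nat \<Rightarrow> real" where
  "top_area p = area_above (real q ^ 2) block_width block_height (left_end p) (reach p) (base_height p) (tilt q p)"

lemma reach_wall:
  assumes "p \<le> q"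
  shows "real (reach p) - 2 \<le> block_width + 1 / real q ^ 2 * base_height p"
proof -
  have "11 / real q \<le> 1" using q by simp
  then show ?thesis using gap_bounds[OF assms] by simp
qed

text \<open>Used both above a new ledge, up to the top of the block, and to close off the block
  after the last layer. Staying 2 to the left of \<open>reach p\<close> keeps the columns inside the
  wall; rounding costs at most 1 per column.\<close>

lemma packs_top_columns:
  assumes p: "p \<le> q" and m: "a + m + 2 \<le> reach p"
  defines "h \<equiv> real block_height - base_height p" and "t \<equiv> tilt q p"
  shows "packs {z. a \<le> z $ 1 \<and> z $ 1 \<le> real a + m \<and> base_height p + t * z $ 1 \<le> z $ 2 \<and> z $ 2 \<le> block_height \<and>
    z $ 1 \<le> block_width + 1 / real q ^ 2 * z $ 2} (m * (h - 1) - t * (real m * a + real m * (real m + 1) / 2))"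
proof -
  have t: "0 < t" using tilt_bounds(1)[OF q tilt_range[OF q p]] by (simp add: t_def)
  define f where "f = (\<lambda>i :: nat. nat \<lfloor>h - t * (real a + i + 1)\<rfloor>)"
  have "packable {z. real a \<le> z $ 1 \<and> z $ 1 \<le> real a + m \<and> base_height p + t * z $ 1 \<le> z $ 2 \<and>
    z $ 2 \<le> block_height + 0 * z $ 1 \<and> z $ 1 \<le> block_width + 1 / real q ^ 2 * z $ 2} (\<Sum>i<m. f i)"
  proof (rule packable_columns)
    fix i assume i: "i < m"
    have "real a + i + 1 \<le> real (reach p) - 2" using i m by linarith
    also have "\<dots> \<le> block_width + 1 / real q ^ 2 * base_height p" by (rule reach_wall[OF p])
    also have "\<dots> \<le> block_width + 1 / real q ^ 2 * (base_height p + t * (real a + i + 1))"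
      using t by (intro add_left_mono mult_left_mono) auto
    finally have wall: "real a + i + 1 \<le> block_width + 1 / real q ^ 2 * (base_height p + t * (real a + i + 1))" .
    show "f i = 0 \<or> base_height p + t * (real a + i + 1) + f i \<le> block_height + 0 * (real a + i) \<and>
      real a + i + 1 \<le> block_width + 1 / real q ^ 2 * (base_height p + t * (real a + i + 1))"
    proof (cases "f i = 0")
      case False
      then have "real (f i) \<le> h - t * (real a + i + 1)" unfolding f_def by linarith
      then show ?thesis using wall by (simp add: h_def)
    qed simp
  qed (use t in auto)
  moreover have "real (\<Sum>i<m. f i) \<ge> m * (h - 1) - t * (real m * a + real m * (real m + 1) / 2)"
    unfolding f_def of_nat_sum by (rule sum_floor_ge)
  ultimately show ?thesis by (simp add: packs_of_packable)
qed

text \<open>Only a height of at most \<open>2 * q\<^sup>2\<close> remains. Rounding of at most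
  \<open>20 * q\<^sup>2\<close> columns costs at most \<open>40 * q\<^sup>2\<close>, the missing
  width 2 at most \<open>4 * q\<^sup>2\<close>, and the part beyond \<open>reach q\<close> at most
  \<open>2 * q\<^sup>2\<close>.\<close>

lemma packs_last_top_part: "packs (top_part q) (top_area q - 50 * real q ^ 2)"
proof -
  define t where "t = tilt q q"
  define Q where "Q = real q ^ 2"
  define X where "X = real (left_end q)"
  define S where "S = real (reach q)"
  define h where "h = real block_height - base_height q"
  define m where "m = rod_length q t - 2"
  have q0: "real q \<ge> 100" using q by simp
  have Q: "100 * real q \<le> Q" using q0 mult_right_mono[of 100 "real q" "real q"] by (simp add: Q_def power2_eq_square)
  note tb = tilt_range[OF q order_refl, folded t_def]
  note b = tilt_bounds[OF q tb] and s = ledge_bounds[OF q tb]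
  have t1: "t \<le> 1"
  proof -
    have "1 / real q \<le> 1" using q0 by simp
    then show ?thesis using tb(2) by simp
  qed
  have mS: "X + m = S - 2"
    using left_end_simps(1)[of q] s(9) by (simp add: X_def S_def m_def t_def of_nat_diff flip: of_nat_add)
  have gap: "\<bar>S - block_width - base_height q / Q - 1\<bar> \<le> 1"
  proof -
    have "11 / real q \<le> 1" using q0 by simp
    then show ?thesis using gap_bounds[of q] by (simp add: S_def Q_def)
  qed
  have h: "0 \<le> h" "h \<le> 2 * Q"
  proof -
    have "real block_height = q * Q + Q" by (simp add: block_height_def Q_def power2_eq_square algebra_simps)
    then show "0 \<le> h" "h \<le> 2 * Q"
      using base_height_bounds[OF order_refl] Q q0 by (auto simp: h_def Q_def)
  qed
  have "left_end q + m + 2 = reach q"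
    using left_end_simps(1)[of q] s(9) by (simp add: m_def t_def)
  then have P: "packs (top_part q) (m * (h - 1) - t * (m * X + m * (real m + 1) / 2))"
    using packs_top_columns[of q "left_end q" m]
    by (auto simp: top_part_def h_def t_def X_def elim!: packs_mono)
  have "m * (h - 1) - t * (m * X + m * (real m + 1) / 2) \<ge> top_area q - 50 * Q"
  proof -
    define g where "g = block_width + real block_height / Q - S"
    have Xm: "X = S - 2 - m" using mS by simp
    have "g = h / Q - (S - block_width - base_height q / Q)" by (simp add: g_def h_def diff_divide_distrib)
    moreover have "0 \<le> h / Q" "h / Q \<le> 2" using h Q q0 by (auto simp: divide_le_eq)
    ultimately have "\<bar>g\<bar> \<le> 2" using gap by linarith
    then have g: "g\<^sup>2 \<le> 4" using power_mono[of "\<bar>g\<bar>" 2 2] by simp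
    have "top_area q = (m + 2) * h - t * (S\<^sup>2 - X\<^sup>2) / 2 + Q * g\<^sup>2 / 2"
      by (simp add: top_area_def area_above_def Xm flip: S_def X_def t_def h_def Q_def g_def)
    moreover have "m * (h - 1) - t * (m * X + m * (real m + 1) / 2) =
      (m + 2) * h - t * (S\<^sup>2 - X\<^sup>2) / 2 - 2 * h - m * (1 + t / 2) + t * (S\<^sup>2 - (S - 2)\<^sup>2) / 2"
      unfolding Xm by (simp add: power2_eq_square field_simps)
    moreover have "0 \<le> t * (S\<^sup>2 - (S - 2)\<^sup>2) / 2"
    proof -
      have "2 \<le> S" using mS by (simp add: X_def)
      then have "(S - 2)\<^sup>2 \<le> S\<^sup>2" by (intro power_mono) auto
      then show ?thesis using b(1) by simp
    qed
    moreover have "m * (1 + t / 2) \<le> (20 * Q) * 2"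
      using s(8) t1 b(1) by (intro mult_mono) (auto simp: m_def Q_def)
    moreover have "Q * g\<^sup>2 \<le> Q * 4" using g by (intro mult_left_mono) (auto simp: Q_def)
    ultimately show ?thesis using h Q q0 by linarith
  qed
  then show ?thesis by (intro packs_mono[OF P order_refl]) (simp add: Q_def)
qed

text \<open>In \<open>area_above_step\<close> the terms of order \<open>q\<^sup>2\<close> cancel by
  \<open>tooth_area_bound\<close>. What remains is bounded by \<open>30 * q\<close>,
  \<open>50 * q\<close>, \<open>11 * q\<close> and \<open>22 * q\<close>, and by
  \<open>2 * d\<close> for the columns.\<close>

lemma top_area_step:
  assumes p: "p < q"
  defines "d \<equiv> left_end (Suc p) - left_end p" and "t \<equiv> tilt q (Suc p)"
  shows "top_area p \<le> top_area (Suc p) + q * q * rod_length q (tilt q p)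
    + (d * (block_height - base_height (Suc p) - 1) - t * (d * left_end p + d * (real d + 1) / 2)) + 200 * q + 2 * d"
proof -
  define Q where "Q = real q ^ 2"
  define L where "L = real (rod_length q (tilt q p))"
  define e where "e = q * (sqrt (1 + (tilt q p)\<^sup>2) - 1) + tilt q p"
  define S where "S = real (reach p)"
  have q0: "real q \<ge> 100" using q by simp
  have Qq: "Q = real q * q" by (simp add: Q_def power2_eq_square)
  have p': "p \<le> q" "Suc p \<le> q" using p by auto
  note tb = tilt_range[OF q p'(1)] and tb' = tilt_range[OF q p'(2), folded t_def]
  note s = ledge_bounds[OF q tb, folded L_def]
  have SL: "S - left_end p = L" using left_end_simps(1)[OF p'(1)] by (simp add: S_def L_def flip: of_nat_add)
  have d: "real (left_end (Suc p)) - left_end p = d" using left_end_simps(3)[OF p] by (simp add: d_def of_nat_diff)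
  have S': "real (reach (Suc p)) = S + 1" by (simp add: S_def reach_def)
  have "top_area p - top_area (Suc p) - Q * L
      - (d * (block_height - base_height (Suc p) - 1) - t * (d * left_end p + d * (real d + 1) / 2))
    = L * e + (t - tilt q p) * L\<^sup>2 / 2 + d * (1 + t / 2) + Q * (1 - (S + 1 - block_width - base_height (Suc p) / Q))
      + t * (S + 1 / 2) - Q / 2"
  proof -
    have "Q \<noteq> 0" using q0 by (simp add: Q_def)
    moreover have "base_height (Suc p) = base_height p + Q + e - (t - tilt q p) * left_end p"
      by (simp add: Q_def e_def t_def)
    ultimately have "area_above Q block_width block_height (left_end p) S (base_height p) (tilt q p)
        - area_above Q block_width block_height (left_end (Suc p)) (S + 1) (base_height (Suc p)) t - Q * (S - left_end p)
        - ((real (left_end (Suc p)) - left_end p) * (block_height - base_height (Suc p) - 1)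
          - t * ((real (left_end (Suc p)) - left_end p) * left_end p
            + (real (left_end (Suc p)) - left_end p) * (real (left_end (Suc p)) - left_end p + 1) / 2))
      = (S - left_end p) * e + (t - tilt q p) * (S - left_end p)\<^sup>2 / 2
        + (real (left_end (Suc p)) - left_end p) * (1 + t / 2)
        + Q * (1 - (S + 1 - block_width - base_height (Suc p) / Q)) + t * (S + 1 / 2) - Q / 2"
      by (rule area_above_step)
    then show ?thesis
      unfolding SL d top_area_def S' Q_def[symmetric] S_def[symmetric] t_def[symmetric]
      by (simp only: of_nat_mult of_nat_add of_nat_1)
  qed
  moreover have "L * e \<le> 30 * q"
  proof -
    have "L * e \<le> (20 * Q) * (3 / (2 * real q))"
      using s(8) base_height_step[OF p] by (intro mult_mono) (auto simp: Q_def e_def L_def)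
    also have "\<dots> = 30 * q" using q0 by (simp add: Qq)
    finally show ?thesis .
  qed
  moreover have "(t - tilt q p) * L\<^sup>2 \<le> Q + 100 * q"
    using tooth_area_bound[OF q tb] by (simp add: t_def L_def Q_def tilt.simps[OF q])
  moreover have "d * (1 + t / 2) \<le> real d * 2"
  proof (rule mult_left_mono)
    have "1 / real q \<le> 1" using q0 by simp
    then show "1 + t / 2 \<le> 2" using tb'(2) by linarith
  qed simp
  moreover have "Q * (1 - (S + 1 - block_width - base_height (Suc p) / Q)) \<le> Q * (11 / q)"
    using gap_bounds[OF p'(2)] by (intro mult_left_mono) (auto simp: S' Q_def abs_le_iff)
  moreover have "Q * (11 / q) = 11 * q" using q0 by (simp add: Qq)
  moreover have "t * (S + 1 / 2) \<le> (1 / q) * (22 * Q)"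
  proof (rule mult_mono)
    have "1 \<le> Q" using q0 mult_mono[of 1 "real q" 1 "real q"] by (simp add: Qq)
    then show "S + 1 / 2 \<le> 22 * Q" using reach_le[OF p'(1)] by (simp add: S_def Q_def)
  qed (use tb' in \<open>auto simp: S_def\<close>)
  moreover have "(1 / q) * (22 * Q) = 22 * q" using q0 by (simp add: Qq)
  moreover have "real (q * q * rod_length q (tilt q p)) = Q * L" by (simp add: Qq L_def)
  ultimately show ?thesis by simp
qed

text \<open>A point above the block would satisfy
  \<open>y * (1 - t / Q) \<le> q * Q + 31 * q\<close>, but at the top of the block the left side is
  already at least \<open>q * Q + Q - 2\<close>.\<close>

lemma layer_below_top:
  fixes x y :: real
  assumes p: "p \<le> q" and z: "y \<le> base_height p + tilt q p * x" "x \<le> block_width + 1 / real q ^ 2 * y"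
  shows "y \<le> block_height"
proof (rule ccontr)
  assume "\<not> y \<le> block_height"
  then have y: "real block_height < y" by simp
  define t Q where "t = tilt q p" and "Q = real q ^ 2"
  have q0: "real q \<ge> 100" using q by simp
  have Qq: "Q = real q * q" by (simp add: Q_def power2_eq_square)
  have t: "0 < t" "t \<le> 1 / q" using tilt_bounds(1)[OF q tilt_range[OF q p]] tilt_range(2)[OF q p] by (auto simp: t_def)
  have H: "real block_height = q * Q + Q" by (simp add: block_height_def Qq power2_eq_square algebra_simps)
  have Q: "100 * real q \<le> Q" using q0 by (simp add: Qq mult_right_mono)
  have "t * x \<le> t * (block_width + 1 / Q * y)" using z t by (intro mult_left_mono) (auto simp: Q_def)
  then have "y * (1 - t / Q) \<le> base_height p + t * block_width" using z(1) by (simp add: t_def algebra_simps)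
  also have "\<dots> \<le> q * Q + 31 * q"
  proof -
    have "t * block_width \<le> (1 / q) * (20 * Q)"
      using t block_width_simps(2) by (intro mult_mono) (auto simp: Q_def)
    also have "\<dots> = 20 * q" using q0 by (simp add: Qq)
    finally have "t * block_width \<le> 20 * q" .
    moreover have "base_height p \<le> p * Q + 11 * p" using base_height_bounds[OF p] by (simp add: Q_def)
    moreover have "p * Q \<le> q * Q" using p by (intro mult_right_mono) (auto simp: Q_def)
    ultimately show ?thesis using p by linarith
  qed
  finally have up: "y * (1 - t / Q) \<le> q * Q + 31 * q" .
  have tQ: "t / Q * (q * Q + Q) \<le> 2"
  proof -
    have "t / Q * (q * Q + Q) = t * (q + 1)" using Q q0 by (simp add: field_simps)
    also have "\<dots> \<le> (1 / q) * (q + 1)" using t by (intro mult_right_mono) auto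
    also have "\<dots> \<le> 2" using q0 by (simp add: field_simps)
    finally show ?thesis .
  qed
  have "0 \<le> 1 - t / Q"
  proof -
    have "t \<le> 1" using t(2) q0 by (meson divide_le_eq_1 le_numeral_extra(4) order_trans one_le_numeral zero_less_one less_le_trans)
    then show ?thesis using Q q0 by (simp add: divide_le_eq)
  qed
  then have "real block_height * (1 - t / Q) \<le> y * (1 - t / Q)" using y by (intro mult_right_mono) auto
  moreover have "real block_height * (1 - t / Q) = q * Q + Q - t / Q * (q * Q + Q)"
    unfolding H by (simp add: algebra_simps)
  ultimately show False using up tQ Q q0 by linarith
qed

text \<open>Downward induction from the closed-off top: \<open>top_part p\<close> receives layer
  \<open>p\<close>, the columns above its new ledge, and \<open>top_part (Suc p)\<close>. The column
  losses telescope to the total shift of the left ends.\<close>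

lemma packs_top_part:
  assumes "p \<le> q"
  shows "packs (top_part p) (top_area p - 200 * q * (real q - p) - 2 * (real (left_end q) - left_end p) - 50 * real q ^ 2)"
  using assms
proof (induction p rule: inc_induct)
  case base
  then show ?case using packs_last_top_part by simp
next
  case (step p)
  then have p: "p \<le> q" "Suc p \<le> q" "p < q" by auto
  define t t' where "t = tilt q p" and "t' = tilt q (Suc p)"
  define d where "d = left_end (Suc p) - left_end p"
  have tt: "t \<le> t'" using tilt_mono[OF q p(3)] by (simp add: t_def t'_def)
  have d: "left_end p + d = left_end (Suc p)" using left_end_simps(3)[OF p(3)] by (simp add: d_def)
  let ?wall = "\<lambda>z :: plane. z $ 1 \<le> block_width + 1 / real q ^ 2 * z $ 2"
  let ?A = "{z. left_end p \<le> z $ 1 \<and> base_height p + t * z $ 1 \<le> z $ 2 \<and>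
    z $ 2 \<le> base_height (Suc p) + t' * z $ 1 \<and> ?wall z}"
  let ?C = "{z. left_end p \<le> z $ 1 \<and> z $ 1 \<le> real (left_end p) + d \<and> base_height (Suc p) + t' * z $ 1 \<le> z $ 2 \<and>
    z $ 2 \<le> block_height \<and> ?wall z}"
  let ?B = "{z. left_end p \<le> z $ 1 \<and> base_height (Suc p) + t' * z $ 1 \<le> z $ 2 \<and> z $ 2 \<le> block_height \<and> ?wall z}"
  let ?c = "d * (block_height - base_height (Suc p) - 1) - t' * (real d * left_end p + d * (real d + 1) / 2)"
  let ?u = "top_area (Suc p) - 200 * q * (real q - Suc p) - 2 * (real (left_end q) - left_end (Suc p)) - 50 * real q ^ 2"
  have A: "packs ?A (q * q * rod_length q t)"
    using packable_layer[OF p(3)] by (intro packs_of_packable) (auto simp: t_def t'_def simp del: base_height.simps)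
  have len2: "2 \<le> rod_length q t'" using ledge_bounds(9)[OF q tilt_range[OF q p(2)]] by (simp add: t'_def)
  have "left_end (Suc p) + 2 \<le> reach (Suc p)" using left_end_simps(1)[OF p(2)] len2 by (simp add: t'_def)
  then have C: "packs ?C ?c"
    using packs_top_columns[OF p(2), of "left_end p" d] d by (simp add: t'_def del: base_height.simps)
  have "packs ?B (?c + ?u)"
  proof (rule packs_Un_line[OF C step.IH, where \<alpha> = 1 and \<beta> = 0 and \<gamma> = "left_end (Suc p)"])
    show "top_part (Suc p) \<subseteq> ?B"
      using d by (auto simp: top_part_def t'_def simp del: base_height.simps)
  qed (use d in \<open>auto simp: top_part_def simp del: base_height.simps\<close>)
  then have "packs (top_part p) (real (q * q * rod_length q t) + (?c + ?u))"
  proof (rule packs_Un_line[OF A, where \<alpha> = "- t'" and \<beta> = 1 and \<gamma> = "base_height (Suc p)"])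
    show "?A \<subseteq> top_part p"
      using layer_below_top[OF p(2)] by (auto simp: top_part_def t_def t'_def simp del: base_height.simps)
    have "base_height p + t * x \<le> base_height (Suc p) + t' * x" if "left_end p \<le> x" for x :: real
    proof -
      have "0 \<le> (t' - t) * (x - left_end p)" using that tt by simp
      moreover have "0 \<le> real q ^ 2 + (q * (sqrt (1 + t\<^sup>2) - 1) + t)"
        using base_height_step(2)[OF p(3)] by (simp add: t_def)
      ultimately show ?thesis by (simp add: t_def t'_def algebra_simps)
    qed
    then show "?B \<subseteq> top_part p"
      by (force simp: top_part_def t_def simp del: base_height.simps)
  qed (auto simp del: base_height.simps)
  moreover have "top_area p - 200 * q * (real q - p) - 2 * (real (left_end q) - left_end p) - 50 * real q ^ 2
      \<le> real (q * q * rod_length q t) + (?c + ?u)"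
  proof -
    have *: "a - P - 2 * (x - l) - R \<le> N + (c + (a' - P' - 2 * (x - l') - R))"
      if "a \<le> a' + N + c + u + 2 * d'" "P' = P - u" "l' = l + d'" for a a' P P' x l l' R N c u d' :: real
      using that by simp
    show ?thesis
    proof (rule *)
      show "top_area p \<le> top_area (Suc p) + real (q * q * rod_length q t) + ?c + real (200 * q) + 2 * real d"
        using top_area_step[OF p(3), folded t_def t'_def d_def] by (simp only: of_nat_mult)
      show "200 * q * (real q - Suc p) = 200 * q * (real q - p) - real (200 * q)"
        by (simp add: algebra_simps)
      show "real (left_end (Suc p)) = left_end p + real d" using d by (simp flip: of_nat_add)
    qed
  qed
  ultimately show ?case by (meson packs_mono order_refl)
qed

text \<open>The main term is the exact area of the trapezoid. Columns fill the triangle below the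
  first layer, \<open>top_part 0\<close> the rest; the \<open>q\<close> layers contribute a loss of
  \<open>200 * q\<close> each, and all other losses are also of order
  \<open>q\<^sup>2\<close>.\<close>

lemma packs_block:
  "packs {z. 0 \<le> z $ 1 \<and> z $ 1 \<le> block_width + 1 / real q ^ 2 * z $ 2 \<and> 0 \<le> z $ 2 \<and> z $ 2 \<le> block_height}
    (real block_width * block_height + real block_height ^ 2 / (2 * real q ^ 2) - 500 * real q ^ 2)"
proof -
  define t Q W where "t = tilt q 0" and "Q = real q ^ 2" and "W = real block_width"
  have q0: "real q \<ge> 100" using q by simp
  have Qq: "Q = real q * q" by (simp add: Q_def power2_eq_square)
  have Q: "100 * real q \<le> Q" using q0 by (simp add: Qq mult_right_mono)
  note tb = tilt_range[OF q, of 0, folded t_def]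
  have t: "0 < t" "t \<le> 1" using tilt_bounds(1)[OF q tb] tb(2) q0 by (auto simp: order_trans[of t "1 / q" 1])
  let ?R = "{z :: plane. 0 \<le> z $ 1 \<and> z $ 1 \<le> block_width + 1 / real q ^ 2 * z $ 2 \<and> 0 \<le> z $ 2 \<and> z $ 2 \<le> block_height}"
  let ?B = "{z :: plane. 0 \<le> z $ 1 \<and> z $ 1 \<le> 0 + real block_width \<and> 0 + 0 * z $ 1 \<le> z $ 2 \<and> z $ 2 \<le> 0 + t * z $ 1 \<and>
    z $ 1 \<le> block_width + 1 / real q ^ 2 * z $ 2}"
  have "packable ?B (\<Sum>i<block_width. nat \<lfloor>t * i\<rfloor>)"
  proof (rule packable_columns)
    fix i assume "i < block_width"
    then have "0 + real i + 1 \<le> real block_width + 1 / real q ^ 2 * (0 + 0 * (0 + real i + 1))" by simp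
    moreover have "0 + 0 * (0 + real i + 1) + real (nat \<lfloor>t * i\<rfloor>) \<le> 0 + t * (0 + real i)"
      using t by simp
    ultimately show "nat \<lfloor>t * i\<rfloor> = 0 \<or>
      0 + 0 * (0 + real i + 1) + real (nat \<lfloor>t * i\<rfloor>) \<le> 0 + t * (0 + real i) \<and>
      0 + real i + 1 \<le> real block_width + 1 / real q ^ 2 * (0 + 0 * (0 + real i + 1))" by blast
  qed (use t in auto)
  moreover have "t * (W * (W - 1) / 2) - W \<le> (\<Sum>i<block_width. real (nat \<lfloor>t * i\<rfloor>))"
  proof -
    have "(\<Sum>i<n. t * real i - 1) = t * (real n * (real n - 1) / 2) - n" for n
      by (induction n) (auto simp: field_simps)
    moreover have "(\<Sum>i<block_width. t * real i - 1) \<le> (\<Sum>i<block_width. real (nat \<lfloor>t * i\<rfloor>))"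
      by (intro sum_mono) linarith
    ultimately show ?thesis by (simp add: W_def)
  qed
  ultimately have B: "packs ?B (t * (W * (W - 1) / 2) - W)"
    by (simp add: packs_of_packable)
  have T: "packs (top_part 0) (top_area 0 - 200 * Q - 2 * real (left_end q) - 50 * Q)"
    using packs_top_part[of 0] by (simp add: left_end_simps(2) Q_def power2_eq_square mult.assoc)
  have H: "t * block_width \<le> block_height"
  proof -
    have "t * block_width \<le> 1 * (20 * Q)" using t block_width_simps(2) by (intro mult_mono) (auto simp: Q_def)
    also have "\<dots> \<le> q * Q" using mult_right_mono[of 20 "real q" Q] q0 Q by simp
    also have "\<dots> \<le> block_height" by (simp add: block_height_def Qq power2_eq_square algebra_simps)
    finally show ?thesis by simp
  qed
  have "packs ?R ((t * (W * (W - 1) / 2) - W) + (top_area 0 - 200 * Q - 2 * real (left_end q) - 50 * Q))"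
  proof (rule packs_Un_line[OF B T, where \<alpha> = "- t" and \<beta> = 1 and \<gamma> = 0])
    show "?B \<subseteq> ?R"
    proof safe
      fix z :: plane assume z: "z $ 1 \<le> 0 + real block_width" "z $ 2 \<le> 0 + t * z $ 1"
      then have "t * z $ 1 \<le> t * block_width" using t by (intro mult_left_mono) auto
      then show "z $ 2 \<le> block_height" using H z by linarith
    qed auto
    show "top_part 0 \<subseteq> ?R"
    proof
      fix z assume z: "z \<in> top_part 0"
      then have "0 \<le> t * z $ 1" using t by (simp add: top_part_def left_end_simps(2))
      then show "z \<in> ?R" using z by (simp add: top_part_def left_end_simps(2) t_def)
    qed
  qed (auto simp: top_part_def t_def)
  moreover have "W * block_height + real block_height ^ 2 / (2 * Q) - 500 * Q
    \<le> (t * (W * (W - 1) / 2) - W) + (top_area 0 - 200 * Q - 2 * real (left_end q) - 50 * Q)"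
  proof -
    define H where "H = real block_height"
    have h: "top_area 0 = (W + 1) * H - t * (W + 1)\<^sup>2 / 2 + Q * (H / Q - 1)\<^sup>2 / 2"
      using block_width_simps(3)[of 0]
      by (simp add: top_area_def area_above_def left_end_simps(2) Q_def H_def t_def W_def algebra_simps)
    have "1 \<le> Q" using Q q0 by linarith
    then have Q0: "Q > 0" by linarith
    define K where "K = H\<^sup>2 / (2 * Q)"
    have E: "Q * (H / Q - 1)\<^sup>2 / 2 = K - H + Q / 2"
      using Q0 by (simp add: K_def power2_eq_square field_simps)
    define B where "B = t * (3 * W + 1)"
    have A: "(t * (W * (W - 1) / 2) - W) + top_area 0 = W * H + K + Q / 2 - W - B / 2"
      unfolding h E B_def by (simp add: power2_eq_square field_simps)
    have "B \<le> 1 * (3 * W + 1)" unfolding B_def using t by (intro mult_right_mono) (auto simp: W_def)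
    moreover have "W \<le> 20 * Q" using block_width_simps(2) by (simp add: W_def Q_def)
    moreover have "real (left_end q) \<le> 21 * Q" using left_end_simps(1)[of q] reach_le[of q] by (simp add: Q_def)
    ultimately have "W + B / 2 + 200 * Q + 2 * real (left_end q) + 50 * Q \<le> 500 * Q + Q / 2"
      using \<open>1 \<le> Q\<close> by simp
    then have "W * H + K - 500 * Q
      \<le> ((t * (W * (W - 1) / 2) - W) + top_area 0) - 200 * Q - 2 * real (left_end q) - 50 * Q"
      unfolding A by linarith
    then have "W * H + K - 500 * Q
      \<le> (t * (W * (W - 1) / 2) - W) + (top_area 0 - 200 * Q - 2 * real (left_end q) - 50 * Q)"
      by (simp only: add_diff_eq)
    then show ?thesis by (simp only: H_def K_def)
  qed
  ultimately show ?thesis by (auto simp: W_def Q_def elim!: packs_mono)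
qed

end

subsection \<open>Trapezoids, strips and the large square\<close>

lemma packs_translate:
  "packs {z. P (z $ 1) (z $ 2)} r \<Longrightarrow> packs {z. P (z $ 1 - a) (z $ 2 - b)} r"
  unfolding packs_def using packable_translate by blast

lemma packs_rotate:
  "packs {z. P (z $ 1) (z $ 2)} r \<Longrightarrow> packs {z. P (a - z $ 1) (b - z $ 2)} r"
  unfolding packs_def using packable_rotate by blast

lemma packs_swap:
  "packs {z. P (z $ 1) (z $ 2)} r \<Longrightarrow> packs {z. P (z $ 2) (z $ 1)} r"
  unfolding packs_def using packable_swap by blast

text \<open>Wastes up to 2 per row, which is affordable only for heights of order
  \<open>q\<^sup>3\<close>.\<close>

lemma packs_rows:
  fixes Q V :: real
  assumes "1 \<le> Q"
  shows "packs {z. 0 \<le> z $ 1 \<and> z $ 1 \<le> V + 1 / Q * z $ 2 \<and> 0 \<le> z $ 2 \<and> z $ 2 \<le> real m}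
    (V * m + real m ^ 2 / (2 * Q) - 2 * m)"
proof -
  have "(\<Sum>i<m. V + \<tau> * real i - 1) = V * m + \<tau> * real m ^ 2 / 2 - \<tau> * m / 2 - m" for \<tau> and m :: nat
    by (induction m) (auto simp: field_simps power2_eq_square)
  from this[of "1 / Q" m]
  have sum: "(\<Sum>i<m. V + 1 / Q * real i - 1) = V * m + real m ^ 2 / (2 * Q) - m / (2 * Q) - m" by simp
  have "(\<Sum>i<m. V + 1 / Q * real i - 1) \<le> (\<Sum>i<m. real (nat \<lfloor>V + 1 / Q * i\<rfloor>))"
    by (intro sum_mono) linarith
  moreover have "real m / (2 * Q) \<le> m / 1" using assms by (intro divide_left_mono) auto
  ultimately have "V * m + real m ^ 2 / (2 * Q) - 2 * m \<le> real (\<Sum>i<m. nat \<lfloor>V + 1 / Q * i\<rfloor>)"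
    unfolding sum by simp
  then show ?thesis using packable_rows[of "1 / Q" V m] assms by (intro packs_of_packable) auto
qed

context
  fixes q :: nat
  assumes q: "100 \<le> q"
begin

text \<open>At an integer wall position \<open>A\<close> the space to the left of a block is an
  integer rectangle and wastes nothing. The next level starts at \<open>A + q + 1\<close>, again an
  integer, hence the induction with \<open>A\<close> arbitrary.\<close>

lemma packs_blocks:
  assumes "block_width q \<le> A"
  shows "packs {z. 0 \<le> z $ 1 \<and> z $ 1 \<le> real A + 1 / real q ^ 2 * z $ 2 \<and> 0 \<le> z $ 2 \<and>
      z $ 2 \<le> real (K * block_height q + m)}
    (real A * real (K * block_height q + m) + real (K * block_height q + m) ^ 2 / (2 * real q ^ 2)
      - 500 * real q ^ 2 * K - 2 * m)"
  using assms
proof (induction K arbitrary: A)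
  case 0
  have "1 \<le> real q ^ 2" using q by simp
  from packs_rows[OF this, of A m] show ?case by simp
next
  case (Suc K)
  define Q H W N where "Q = real q ^ 2" and "H = real (block_height q)" and "W = real (block_width q)"
    and "N = real (K * block_height q + m)"
  let ?R = "{z :: plane. 0 \<le> z $ 1 \<and> z $ 1 \<le> real A + 1 / Q * z $ 2 \<and> 0 \<le> z $ 2 \<and> z $ 2 \<le> H + N}"
  have Q0: "Q > 0" using q by (simp add: Q_def)
  have H: "H = Q * (real q + 1)" by (simp add: H_def Q_def block_height_def[OF q] distrib_left)
  define d where "d = A - block_width q"
  have d: "real d = A - W" using Suc.prems by (simp add: d_def W_def of_nat_diff)
  have d0: "0 \<le> A - W" using Suc.prems by (simp add: W_def)
  let ?L = "{z :: plane. 0 \<le> z $ 1 \<and> z $ 1 \<le> 0 + real d \<and> 0 \<le> z $ 2 \<and> z $ 2 \<le> 0 + real (block_height q)}"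
  let ?B = "{z :: plane. 0 \<le> z $ 1 - (A - W) \<and> z $ 1 - (A - W) \<le> W + 1 / Q * (z $ 2 - 0) \<and>
    0 \<le> z $ 2 - 0 \<and> z $ 2 - 0 \<le> H}"
  let ?T = "{z :: plane. 0 \<le> z $ 1 - 0 \<and> z $ 1 - 0 \<le> real (A + q + 1) + 1 / Q * (z $ 2 - H) \<and>
    0 \<le> z $ 2 - H \<and> z $ 2 - H \<le> N}"
  let ?LB = "{z :: plane. 0 \<le> z $ 1 \<and> z $ 1 \<le> real A + 1 / Q * z $ 2 \<and> 0 \<le> z $ 2 \<and> z $ 2 \<le> H}"
  have L: "packs ?L ((A - W) * H)"
    using packable_block[of 0 d 0 "block_height q"] by (rule packs_of_packable) (simp add: d H_def)
  have "packs {z. 0 \<le> z $ 1 \<and> z $ 1 \<le> W + 1 / Q * z $ 2 \<and> 0 \<le> z $ 2 \<and> z $ 2 \<le> H}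
    (W * H + H\<^sup>2 / (2 * Q) - 500 * Q)"
    using packs_block[OF q] by (simp add: W_def Q_def H_def)
  from packs_translate[OF this, of "A - W" 0]
  have B: "packs ?B (W * H + H\<^sup>2 / (2 * Q) - 500 * Q)" .
  have LB: "packs ?LB ((A - W) * H + (W * H + H\<^sup>2 / (2 * Q) - 500 * Q))"
  proof (rule packs_Un_line[OF L B, where \<alpha> = 1 and \<beta> = 0 and \<gamma> = "A - W"])
    show "?L \<subseteq> ?LB"
    proof safe
      fix z :: plane assume z: "z $ 1 \<le> 0 + real d" "0 \<le> z $ 2" "z $ 2 \<le> 0 + real (block_height q)"
      have "0 \<le> 1 / Q * z $ 2" using z Q0 by simp
      then show "z $ 1 \<le> real A + 1 / Q * z $ 2" using z d by (simp add: W_def)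
      show "z $ 2 \<le> H" using z by (simp add: H_def)
    qed
    show "?B \<subseteq> ?LB" using d0 by auto
  qed (use d in auto)
  have "packs {z. 0 \<le> z $ 1 \<and> z $ 1 \<le> real (A + q + 1) + 1 / Q * z $ 2 \<and> 0 \<le> z $ 2 \<and> z $ 2 \<le> N}
    (real (A + q + 1) * N + N\<^sup>2 / (2 * Q) - 500 * Q * K - 2 * m)"
    using Suc.IH[of "A + q + 1"] Suc.prems by (simp add: Q_def N_def)
  from packs_translate[OF this, of 0 H]
  have T: "packs ?T (real (A + q + 1) * N + N\<^sup>2 / (2 * Q) - 500 * Q * K - 2 * m)" .
  have "packs ?R (((A - W) * H + (W * H + H\<^sup>2 / (2 * Q) - 500 * Q)) +
    (real (A + q + 1) * N + N\<^sup>2 / (2 * Q) - 500 * Q * K - 2 * m))"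
  proof (rule packs_Un_line[OF LB T, where \<alpha> = 0 and \<beta> = 1 and \<gamma> = H])
    have "0 \<le> N" by (simp add: N_def)
    then show "?LB \<subseteq> ?R" by auto
    have HQ: "H / Q = real q + 1" using Q0 by (simp add: H)
    have "0 \<le> H" by (simp add: H_def)
    then show "?T \<subseteq> ?R" by (auto simp: diff_divide_distrib HQ)
  qed auto
  moreover have "((A - W) * H + (W * H + H\<^sup>2 / (2 * Q) - 500 * Q)) +
      (real (A + q + 1) * N + N\<^sup>2 / (2 * Q) - 500 * Q * K - 2 * m)
    = real A * (H + N) + (H + N)\<^sup>2 / (2 * Q) - 500 * Q * real (Suc K) - 2 * m"
    unfolding H using Q0 by (simp add: field_simps power2_eq_square)
  moreover have "real (Suc K * block_height q + m) = H + N" by (simp add: H_def N_def algebra_simps)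
  ultimately show ?case by (simp only: Q_def)
qed

text \<open>Plain rows bring the wall to an integer abscissa, blocks follow, and plain rows fill
  what is left. The blocks cost \<open>O(q\<^sup>2)\<close> per height \<open>q\<^sup>3\<close>, so
  \<open>O(q\<^sup>3)\<close> for a height of order \<open>q\<^sup>4\<close>.\<close>

lemma packs_wedge:
  fixes V h :: real
  assumes V: "block_width q \<le> V" "V \<le> 30 * real q ^ 2" and h: "0 \<le> h" "h \<le> 10 * (real q ^ 2)\<^sup>2"
  shows "packs {z. 0 \<le> z $ 1 \<and> z $ 1 \<le> V + 1 / real q ^ 2 * z $ 2 \<and> 0 \<le> z $ 2 \<and> z $ 2 \<le> h}
    (V * h + h\<^sup>2 / (2 * real q ^ 2) - 6000 * real q ^ 3)"
proof -
  define Q where "Q = real q ^ 2"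
  have q0: "real q \<ge> 100" using q by simp
  have Qq: "Q = real q * q" by (simp add: Q_def power2_eq_square)
  have Q: "100 * real q \<le> Q" using q0 by (simp add: Qq mult_right_mono)
  have Q1: "1 \<le> Q" using Q q0 by linarith
  have q3: "real q ^ 3 = real q * Q" by (simp add: Qq power3_eq_cube)
  have qQ: "100 * Q \<le> real q * Q" using q0 Q1 by (intro mult_right_mono) auto
  let ?R = "{z :: plane. 0 \<le> z $ 1 \<and> z $ 1 \<le> V + 1 / Q * z $ 2 \<and> 0 \<le> z $ 2 \<and> z $ 2 \<le> h}"
  have hQ: "h / Q \<le> 10 * Q" 
  proof -
    have "h \<le> 10 * Q * Q" using h(2) by (simp add: Q_def power2_eq_square)
    then show ?thesis using Q1 by (simp add: divide_le_eq)
  qed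
  \<comment> \<open>Rounding the height down costs less than one row of width at most
    \<open>V + h / Q\<close>, where \<open>V \<le> 30 * Q\<close> and
    \<open>h / Q \<le> 10 * Q\<close>.\<close>
  have sq: "V * h + h\<^sup>2 / (2 * Q) - 40 * Q \<le> V * N + N\<^sup>2 / (2 * Q)"
    if N: "0 \<le> N" "N \<le> h" "h \<le> N + 1" for N
  proof -
    have "V * (h - N) \<le> V * 1" using N V by (intro mult_left_mono) auto
    moreover have "(h\<^sup>2 - N\<^sup>2) / (2 * Q) \<le> (2 * h) / (2 * Q)"
    proof (rule divide_right_mono)
      have "(h - N) * (h + N) \<le> 1 * (2 * h)" using N by (intro mult_mono) auto
      then show "h\<^sup>2 - N\<^sup>2 \<le> 2 * h" by (simp add: power2_eq_square algebra_simps)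
    qed (use Q1 in auto)
    ultimately show ?thesis using hQ V Q1 by (simp add: diff_divide_distrib algebra_simps flip: Q_def)
  qed
  define A where "A = nat \<lceil>V\<rceil>"
  have V0: "0 \<le> V" using V by (meson of_nat_0_le_iff order_trans)
  have A: "V \<le> A" "A < V + 1" using V0 unfolding A_def by linarith+
  \<comment> \<open>At height \<open>y\<close> the wall has reached \<open>A\<close>, and by
    rounding has passed it by less than \<open>1 / Q\<close>.\<close>
  define y where "y = nat \<lceil>(A - V) * Q\<rceil>"
  have AV: "0 \<le> (A - V) * Q" using A Q1 by simp
  then have y: "(A - V) * Q \<le> y" "y < (A - V) * Q + 1" unfolding y_def by linarith+
  have "(A - V) * Q \<le> 1 * Q" using A Q1 by (intro mult_right_mono) auto
  then have yQ: "real y \<le> 2 * Q" using y Q1 by linarith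
  have "packs ?R (V * h + h\<^sup>2 / (2 * Q) - 6000 * (q * Q))"
  proof (cases "h \<le> y")
    case True
    define N where "N = nat \<lfloor>h\<rfloor>"
    have N: "0 \<le> real N" "N \<le> h" "h \<le> real N + 1" using h unfolding N_def by linarith+
    have "V * h + h\<^sup>2 / (2 * Q) - 6000 * (q * Q) \<le> V * N + real N ^ 2 / (2 * Q) - 2 * N"
      using sq[OF N] True N yQ qQ by linarith
    with packs_rows[OF Q1, of V N] show ?thesis
      using N by (elim packs_mono) auto
  next
    case False
    define n where "n = nat \<lfloor>h - y\<rfloor>"
    have n: "n \<le> h - y" "h - y < n + 1" using False unfolding n_def by linarith+
    define K m where "K = n div block_height q" and "m = n mod block_height q"
    have nKm: "n = K * block_height q + m" by (simp add: K_def m_def)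
    let ?B = "{z :: plane. 0 \<le> z $ 1 \<and> z $ 1 \<le> V + 1 / Q * z $ 2 \<and> 0 \<le> z $ 2 \<and> z $ 2 \<le> real y}"
    let ?T = "{z :: plane. 0 \<le> z $ 1 - 0 \<and> z $ 1 - 0 \<le> real A + 1 / Q * (z $ 2 - real y) \<and>
      0 \<le> z $ 2 - real y \<and> z $ 2 - real y \<le> real n}"
    have "block_width q \<le> A" using V A by linarith
    from packs_translate[OF packs_blocks[OF this, of K m], of 0 y]
    have T: "packs ?T (real A * n + real n ^ 2 / (2 * Q) - 500 * Q * K - 2 * m)"
      by (simp only: nKm[symmetric] Q_def)
    have "packs ?R ((V * y + real y ^ 2 / (2 * Q) - 2 * y) +
      (real A * n + real n ^ 2 / (2 * Q) - 500 * Q * K - 2 * m))"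
    proof (rule packs_Un_line[OF packs_rows[OF Q1] T, where \<alpha> = 0 and \<beta> = 1 and \<gamma> = y])
      show "?B \<subseteq> ?R" using False by auto
      have "A \<le> V + y / Q" using y(1) Q1 by (simp add: field_simps)
      then show "?T \<subseteq> ?R" using n by (auto simp: diff_divide_distrib)
    qed auto
    moreover have "V * h + h\<^sup>2 / (2 * Q) - 6000 * (q * Q) \<le> (V * y + real y ^ 2 / (2 * Q) - 2 * y) +
      (real A * n + real n ^ 2 / (2 * Q) - 500 * Q * K - 2 * m)"
    proof -
      have "(real y - 1) / Q \<le> A - V" using y(2) Q1 by (simp add: divide_le_eq)
      then have "V + y / Q - 1 / Q \<le> A" by (simp add: diff_divide_distrib)
      then have "(V + y / Q - 1 / Q) * n \<le> real A * n" by (rule mult_right_mono) simp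
      moreover have "(V + y / Q - 1 / Q) * n = V * n + y * n / Q - n / Q"
        using Q1 by (simp add: field_simps)
      moreover have "n / Q \<le> 10 * Q"
      proof -
        have "n / Q \<le> h / Q" using n Q1 by (intro divide_right_mono) auto
        then show ?thesis using hQ by linarith
      qed
      moreover have "(real y + n)\<^sup>2 / (2 * Q) = real y ^ 2 / (2 * Q) + y * n / Q + real n ^ 2 / (2 * Q)"
        using Q1 by (simp add: field_simps power2_eq_square)
      moreover have "V * h + h\<^sup>2 / (2 * Q) - 40 * Q \<le> V * (real y + n) + (real y + n)\<^sup>2 / (2 * Q)"
        using n by (intro sq) auto
      moreover have "V * (real y + n) = V * y + V * n" by (simp add: algebra_simps)
      \<comment> \<open>A block is at least \<open>q\<^sup>3\<close> high and \<open>h\<close> is at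
        most \<open>10 * q\<^sup>4\<close>, so there are at most \<open>10 * q\<close>
        blocks.\<close>
      moreover have "500 * Q * K \<le> 5000 * (q * Q)"
      proof -
        have H: "real (block_height q) \<ge> q * Q" by (simp add: block_height_def[OF q] Q_def algebra_simps)
        have "K * (q * Q) \<le> real K * real (block_height q)" using H by (intro mult_left_mono) auto
        also have "\<dots> \<le> n" using nKm by (simp flip: of_nat_mult)
        also have "\<dots> \<le> 10 * Q\<^sup>2" using n h by (simp add: Q_def)
        finally have "K * q * Q \<le> (10 * Q) * Q" by (simp add: power2_eq_square mult.assoc)
        then have "real K * q \<le> 10 * Q" using Q1 by simp
        then have "real K * q \<le> 10 * q * q" by (simp add: Qq)
        then have "real K \<le> 10 * q" using q0 by simp
        then have "500 * Q * K \<le> 500 * Q * (10 * q)" using Q1 by (intro mult_left_mono) auto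
        then show ?thesis by (simp add: mult.commute)
      qed
      moreover have "real m \<le> 2 * (q * Q)"
      proof -
        have "block_height q > 0" using q by (simp add: block_height_def[OF q])
        then have "m < block_height q" unfolding m_def by simp
        then have "real m \<le> real (block_height q)" by simp
        also have "\<dots> = q * Q + Q" by (simp add: block_height_def[OF q] Q_def algebra_simps)
        finally show ?thesis using qQ Q1 by linarith
      qed
      ultimately show ?thesis using yQ qQ Q1 by linarith
    qed
    ultimately show ?thesis by (elim packs_mono) auto
  qed
  then show ?thesis by (simp add: q3 Q_def)
qed

text \<open>A batch of rods across the strip between two wedges, the right one turned by 180
  degrees. Each of at most \<open>l\<close> rods wastes \<open>c * h - n \<le> 2 / Q\<close>; each
  wedge wastes \<open>6000 * q\<^sup>3\<close>.\<close>

lemma packs_strip: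
  fixes h l :: real and n :: nat
  defines "Q \<equiv> real q ^ 2"
  defines "c \<equiv> sqrt (1 + (1 / Q)\<^sup>2)"
  assumes h: "0 \<le> h" "h \<le> 10 * Q\<^sup>2" and l: "100 * Q \<le> l"
    and n: "n + 1 / Q \<le> c * h" "c * h \<le> n + 2 / Q"
  shows "packs {z. 0 \<le> z $ 1 \<and> z $ 1 \<le> l \<and> 0 \<le> z $ 2 \<and> z $ 2 \<le> h} (l * h - 2 * l / Q - 12000 * real q ^ 3)"
proof -
  have q0: "real q \<ge> 100" using q by simp
  have Qq: "Q = real q * q" by (simp add: Q_def power2_eq_square)
  have "100 * 100 \<le> Q" unfolding Qq using q0 by (intro mult_mono) auto
  then have Q1: "10000 \<le> Q" by simp
  have c: "1 \<le> c" "c \<le> 2"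
  proof -
    show "1 \<le> c" by (simp add: c_def)
    have "1 / Q \<le> 1" using Q1 by simp
    then have "(1 / Q)\<^sup>2 \<le> 1" using Q1 by (intro power_le_one) auto
    then show "c \<le> 2" unfolding c_def by (intro real_le_lsqrt) auto
  qed
  define W where "W = real (block_width q)"
  have W: "0 \<le> W" "W \<le> 20 * Q" using block_width_simps(2)[OF q] by (auto simp: W_def Q_def)
  have hQ: "h / Q \<le> 10 * Q" "0 \<le> h / Q" using h Q1 by (auto simp: divide_le_eq power2_eq_square)
  \<comment> \<open>The number of rods that leaves the right wedge a top width \<open>V\<close>
    between \<open>W\<close> and \<open>W + c\<close>.\<close>
  define M where "M = nat \<lfloor>(l - 2 * W - h / Q) / c\<rfloor>"
  define V where "V = l - W - M * c - h / Q"
  have "0 \<le> (l - 2 * W - h / Q) / c" using l W hQ c by (intro divide_nonneg_pos) auto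
  then have "M \<le> (l - 2 * W - h / Q) / c" "(l - 2 * W - h / Q) / c < M + 1" unfolding M_def by linarith+
  then have M: "M * c \<le> l - 2 * W - h / Q" "l - 2 * W - h / Q < M * c + c"
    using c by (simp_all add: field_simps)
  have V: "W \<le> V" "V \<le> 30 * Q" using M c W Q1 by (auto simp: V_def)
  let ?R = "{z :: plane. 0 \<le> z $ 1 \<and> z $ 1 \<le> l \<and> 0 \<le> z $ 2 \<and> z $ 2 \<le> h}"
  let ?A = "{z :: plane. 0 \<le> z $ 1 \<and> z $ 1 \<le> W + 1 / Q * z $ 2 \<and> 0 \<le> z $ 2 \<and> z $ 2 \<le> h}"
  let ?B = "{z :: plane. 0 \<le> z $ 2 \<and> W + 1 / Q * z $ 2 \<le> z $ 1 \<and> z $ 1 \<le> W + M * c + 1 / Q * z $ 2 \<and>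
    z $ 2 \<le> h + 0 * z $ 1}"
  let ?C = "{z :: plane. 0 \<le> l - z $ 1 \<and> l - z $ 1 \<le> V + 1 / Q * (h - z $ 2) \<and> 0 \<le> h - z $ 2 \<and> h - z $ 2 \<le> h}"
  let ?AB = "{z :: plane. 0 \<le> z $ 1 \<and> z $ 1 \<le> W + M * c + 1 / Q * z $ 2 \<and> 0 \<le> z $ 2 \<and> z $ 2 \<le> h}"
  have A: "packs ?A (W * h + h\<^sup>2 / (2 * Q) - 6000 * real q ^ 3)"
    using packs_wedge[of W h] W h Q1 by (simp add: W_def Q_def)
  have "packs {z. 0 \<le> z $ 1 \<and> z $ 1 \<le> V + 1 / Q * z $ 2 \<and> 0 \<le> z $ 2 \<and> z $ 2 \<le> h}
    (V * h + h\<^sup>2 / (2 * Q) - 6000 * real q ^ 3)"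
    using packs_wedge[of V h] V h by (simp add: W_def Q_def)
  from packs_rotate[OF this, of l h]
  have C: "packs ?C (V * h + h\<^sup>2 / (2 * Q) - 6000 * real q ^ 3)" .
  \<comment> \<open>With coordinates exchanged the rods are nearly horizontal;
    \<open>\<tau> = 0\<close> makes the wall the far side of the strip.\<close>
  have "packable {z. 0 \<le> z $ 1 \<and> W + 1 / Q * z $ 1 \<le> z $ 2 \<and> z $ 2 \<le> W + M * c + 1 / Q * z $ 1 \<and>
    z $ 1 \<le> h + 0 * z $ 2} (M * n)"
    unfolding c_def
  proof (rule packable_batch)
    show "(1 - 0 * (1 / Q)) * (0 + (n + 1 / Q) / sqrt (1 + (1 / Q)\<^sup>2)) \<le> h + 0 * W"
      using n(1) c by (simp add: c_def[symmetric] divide_le_eq mult.commute)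
  qed (use Q1 in auto)
  from packable_swap[OF this]
  have B: "packs ?B (M * real n)" by (rule packs_of_packable) simp
  have shift: "0 \<le> y / Q" "y / Q \<le> h / Q" if "0 \<le> y" "y \<le> h" for y
    using that Q1 by (auto simp: divide_right_mono)
  have AB: "packs ?AB ((W * h + h\<^sup>2 / (2 * Q) - 6000 * real q ^ 3) + M * real n)"
  proof (rule packs_Un_line[OF A B, where \<alpha> = 1 and \<beta> = "- 1 / Q" and \<gamma> = W])
    have "0 \<le> M * c" using c by simp
    then show "?A \<subseteq> ?AB" by auto
    show "?B \<subseteq> ?AB"
    proof
      fix z assume "z \<in> ?B"
      then have z: "0 \<le> z $ 2" "W + z $ 2 / Q \<le> z $ 1" "z $ 1 \<le> W + M * c + z $ 2 / Q" "z $ 2 \<le> h"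
        by auto
      have "0 \<le> z $ 1" using z(2) shift(1)[OF z(1,4)] W by linarith
      then show "z \<in> ?AB" using z by simp
    qed
  qed auto
  have "packs ?R (((W * h + h\<^sup>2 / (2 * Q) - 6000 * real q ^ 3) + M * real n)
    + (V * h + h\<^sup>2 / (2 * Q) - 6000 * real q ^ 3))"
  proof (rule packs_Un_line[OF AB C, where \<alpha> = 1 and \<beta> = "- 1 / Q" and \<gamma> = "W + M * c"])
    have wall: "W + M * c + h / Q \<le> l" using V W by (simp add: V_def)
    show "?AB \<subseteq> ?R"
    proof
      fix z assume "z \<in> ?AB"
      then have z: "0 \<le> z $ 1" "z $ 1 \<le> W + M * c + z $ 2 / Q" "0 \<le> z $ 2" "z $ 2 \<le> h"
        by auto
      have "z $ 1 \<le> l" using z(2) shift(2)[OF z(3,4)] wall by linarith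
      then show "z \<in> ?R" using z by simp
    qed
    show "?C \<subseteq> ?R"
    proof
      fix z assume "z \<in> ?C"
      then have z: "z $ 1 \<le> l" "l - z $ 1 \<le> V + (h - z $ 2) / Q" "0 \<le> h - z $ 2" "h - z $ 2 \<le> h"
        by auto
      have "0 \<le> M * c" using c by simp
      then have "0 \<le> z $ 1" using z(2) shift(2)[OF z(3,4)] W unfolding V_def by linarith
      then show "z \<in> ?R" using z by simp
    qed
    show "W + M * c \<le> 1 * z $ 1 + - 1 / Q * z $ 2" if "z \<in> ?C" for z
      using that by (simp add: V_def diff_divide_distrib)
  qed auto
  moreover have "l * h - 2 * l / Q - 12000 * real q ^ 3 \<le> ((W * h + h\<^sup>2 / (2 * Q) - 6000 * real q ^ 3) + M * real n)
    + (V * h + h\<^sup>2 / (2 * Q) - 6000 * real q ^ 3)"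
  proof -
    have *: "lh - e - 12000 * k \<le> ((wh + s - 6000 * k) + mn) + (vh + s - 6000 * k)"
      if "mch - mn \<le> e" "lh = wh + vh + mch + (s + s)" for lh e k wh s mn vh mch :: real
      using that by simp
    show ?thesis
    proof (rule *)
      have "M * (c * h - n) \<le> l * (2 / Q)"
      proof (rule mult_mono)
        have "real M * 1 \<le> M * c" using c by (intro mult_left_mono) auto
        then show "M \<le> l" using M W hQ by linarith
      qed (use n l Q1 in auto)
      then show "M * c * h - M * real n \<le> 2 * l / Q" by (simp add: algebra_simps)
      have "l * h = W * h + V * h + M * c * h + h\<^sup>2 / Q"
        by (simp add: V_def power2_eq_square algebra_simps)
      then show "l * h = W * h + V * h + M * c * h + (h\<^sup>2 / (2 * Q) + h\<^sup>2 / (2 * Q))" by simp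
    qed
  qed
  ultimately show ?thesis by (elim packs_mono) auto
qed

end

section \<open>Choice of the strip height and assembly of the large square\<close>

text \<open>The height must be congruent to \<open>x\<close> modulo 1 and slightly more than an
  integer after multiplication by \<open>c\<close>. With \<open>h = n - \<delta>\<close> the excess
  \<open>c * h - n\<close> is \<open>n * (c - 1) - c * \<delta>\<close>, which grows in steps
  \<open>c - 1 \<le> 1 / Q\<^sup>2\<close>, so it can be placed between \<open>1 / Q\<close> and
  \<open>2 / Q\<close>.\<close>

lemma exists_strip_height:
  fixes Q x :: real
  assumes Q: "10000 \<le> Q"
  defines "c \<equiv> sqrt (1 + (1 / Q)\<^sup>2)"
  obtains n :: nat and h where "h = x - (\<lceil>x\<rceil> - int n)" "0 \<le> h" "h \<le> 10 * Q\<^sup>2"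
    "n + 1 / Q \<le> c * h" "c * h \<le> n + 2 / Q"
proof -
  define \<tau> where "\<tau> = 1 / Q"
  have \<tau>: "0 < \<tau>" "\<tau> \<le> 1 / 10000" "\<tau> * Q = 1" using Q by (auto simp: \<tau>_def field_simps)
  have \<tau>2: "0 < \<tau>\<^sup>2" "\<tau>\<^sup>2 \<le> \<tau>" using \<tau> by (auto simp: power2_eq_square mult_left_le)
  have cc: "c * c = 1 + \<tau>\<^sup>2" unfolding c_def \<tau>_def by (rule sqrt_one_plus_square)
  have c1: "1 \<le> c" by (simp add: c_def)
  have factor: "(c - 1) * (c + 1) = \<tau>\<^sup>2" using cc by (simp add: algebra_simps)
  have c2: "c - 1 \<le> \<tau>\<^sup>2"
    using mult_left_mono[of 1 "c + 1" "c - 1"] c1 factor by simp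
  then have "c \<le> 11 / 10" using \<tau> \<tau>2 by linarith
  then have "(c - 1) * (c + 1) \<le> (c - 1) * 4" using c1 by (intro mult_left_mono) auto
  then have c3: "\<tau>\<^sup>2 / 4 \<le> c - 1" using factor by simp
  then have c0: "0 < c - 1" using \<tau>2 by linarith
  define \<delta> where "\<delta> = of_int \<lceil>x\<rceil> - x"
  have \<delta>: "0 \<le> \<delta>" "\<delta> \<le> 1" unfolding \<delta>_def by linarith+
  \<comment> \<open>The real solution of \<open>u * (c - 1) - c * \<delta> = 1 / Q\<close>. Since
    \<open>c - 1\<close> is at least \<open>1 / (4 * Q\<^sup>2)\<close>, it is at most
    \<open>8 * Q\<^sup>2\<close>.\<close>
  define u where "u = (c * \<delta> + \<tau>) / (c - 1)"
  have u0: "0 \<le> u" unfolding u_def using c1 \<delta> \<tau> c0 by (intro divide_nonneg_pos) auto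
  define n where "n = nat \<lceil>u\<rceil>"
  have n: "u \<le> n" "n < u + 1" using u0 unfolding n_def by linarith+
  have uc: "u * (c - 1) = c * \<delta> + \<tau>" using c0 by (simp add: u_def)
  define h where "h = n - \<delta>"
  have ch: "c * h - n = n * (c - 1) - c * \<delta>" by (simp add: h_def algebra_simps)
  have lower: "n + 1 / Q \<le> c * h"
    using mult_right_mono[OF n(1), of "c - 1"] c0 uc ch by (simp add: \<tau>_def)
  have "n * (c - 1) \<le> (u + 1) * (c - 1)" using n c0 by (intro mult_right_mono) auto
  then have "n * (c - 1) \<le> c * \<delta> + \<tau> + (c - 1)" using uc by (simp add: algebra_simps)
  then have "c * h \<le> n + 2 * \<tau>" using ch c2 \<tau>2 by linarith
  then have upper: "c * h \<le> n + 2 / Q" by (simp add: \<tau>_def)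
  have "0 \<le> c * h" using lower Q by (meson add_nonneg_nonneg divide_nonneg_nonneg dual_order.trans of_nat_0_le_iff zero_le_one zero_le_numeral)
  then have h0: "0 \<le> h" using c1 by (simp add: zero_le_mult_iff)
  have "u \<le> 2 / (\<tau>\<^sup>2 / 4)"
    unfolding u_def
  proof (rule frac_le)
    have "c * \<delta> \<le> (11 / 10) * 1" using \<open>c \<le> 11 / 10\<close> \<delta> c1 by (intro mult_mono) auto
    then show "c * \<delta> + \<tau> \<le> 2" using \<tau> by linarith
  qed (use c3 \<tau>2 in auto)
  also have "\<dots> = 8 * Q\<^sup>2" using Q by (simp add: \<tau>_def power_divide)
  finally have "u \<le> 8 * Q\<^sup>2" .
  moreover have "1 * 1 \<le> Q * Q" using Q by (intro mult_mono) auto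
  ultimately have "h \<le> 10 * Q\<^sup>2" using n(2) \<delta> by (simp add: h_def power2_eq_square)
  moreover have "h = x - (\<lceil>x\<rceil> - int n)" by (simp add: h_def \<delta>_def)
  ultimately show ?thesis using that h0 lower upper by blast
qed

theorem theorem1:
  "\<exists>C > (0::real). \<exists>x0 > (0::real). \<forall>x \<ge> x0. wasted_space x \<le> C * x powr (3 / 5)"
proof (rule exI[of _ 200000], rule conjI[OF _ exI[of _ "10 ^ 15"]], simp, rule conjI, simp, intro allI impI)
  fix x :: real assume x: "10 ^ 15 \<le> x"
  have x0: "0 < x" using x by (rule order.strict_trans2[rotated]) simp
  define r where "r = x powr (1 / 5)"
  have r5: "r ^ 5 = x" and r3: "r ^ 3 = x powr (3 / 5)"
    using x0 by (simp_all add: r_def powr_power)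
  \<comment> \<open>The threshold \<open>10 ^ 15\<close> is \<open>1000 ^ 5\<close>.\<close>
  have r: "1000 \<le> r"
  proof (rule ccontr)
    assume "\<not> 1000 \<le> r"
    then have "r ^ 5 < 1000 ^ 5" by (intro power_strict_mono) (auto simp: r_def)
    then show False using x r5 by simp
  qed
  define q where "q = nat \<lceil>r\<rceil>"
  have qr: "r \<le> q" "q \<le> 2 * r" using r unfolding q_def by linarith+
  have q: "100 \<le> q" using qr r by linarith
  define Q where "Q = real q ^ 2"
  have Q: "r ^ 2 \<le> Q" "Q \<le> 4 * r ^ 2"
    using power_mono[OF qr(1), of 2] power_mono[OF qr(2), of 2] r by (auto simp: Q_def power_mult_distrib)
  have q3: "real q ^ 3 \<le> 8 * r ^ 3"
    using power_mono[OF qr(2), of 3] r by (simp add: power_mult_distrib)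
  have "1000 ^ 2 \<le> r ^ 2" using r by (intro power_mono) auto
  then have Q1: "10000 \<le> Q" using Q by simp
  obtain n :: nat and h where h: "h = x - (\<lceil>x\<rceil> - int n)" "0 \<le> h" "h \<le> 10 * Q\<^sup>2"
    "n + 1 / Q \<le> sqrt (1 + (1 / Q)\<^sup>2) * h" "sqrt (1 + (1 / Q)\<^sup>2) * h \<le> n + 2 / Q"
    using exists_strip_height[OF Q1] by metis
  \<comment> \<open>The height \<open>h\<close> is of order \<open>r ^ 4\<close>, below half of
    \<open>x = r ^ 5\<close>, so the integer square has side \<open>j \<ge> x / 2\<close>, long
    enough for \<open>packs_strip\<close>.\<close>
  have x2: "h \<le> x / 2" "100 * Q \<le> x / 2"
  proof -
    have "Q\<^sup>2 \<le> (4 * r ^ 2)\<^sup>2" using Q Q1 by (intro power_mono) auto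
    then have "h \<le> 160 * r ^ 4" using h(3) by (simp add: power_mult_distrib flip: power_mult)
    moreover have "320 * r ^ 4 \<le> r * r ^ 4" using r by (intro mult_right_mono) auto
    moreover have "r * r ^ 4 = x" using r5 by (simp flip: power_Suc)
    ultimately show "h \<le> x / 2" by linarith
    have "1000 ^ 3 \<le> r ^ 3" using r by (intro power_mono) auto
    then have "800 * r ^ 2 \<le> r ^ 3 * r ^ 2" by (intro mult_right_mono) auto
    moreover have "r ^ 3 * r ^ 2 = x" using r5 by (simp flip: power_add)
    ultimately show "100 * Q \<le> x / 2" using Q by linarith
  qed
  define j where "j = nat (\<lceil>x\<rceil> - int n)"
  have "0 \<le> \<lceil>x\<rceil> - int n"
  proof -
    have "0 \<le> real_of_int (\<lceil>x\<rceil> - int n)" using h(1) x2(1) x0 by linarith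
    then show ?thesis by linarith
  qed
  then have j: "real j = x - h" using h(1) by (simp add: j_def)
  let ?S = "{z :: plane. 0 \<le> z $ 1 \<and> z $ 1 \<le> x \<and> 0 \<le> z $ 2 \<and> z $ 2 \<le> x}"
  let ?J = "{z :: plane. 0 \<le> z $ 1 \<and> z $ 1 \<le> 0 + real j \<and> 0 \<le> z $ 2 \<and> z $ 2 \<le> 0 + real j}"
  let ?R = "{z :: plane. 0 \<le> z $ 2 - 0 \<and> z $ 2 - 0 \<le> j \<and> 0 \<le> z $ 1 - real j \<and> z $ 1 - real j \<le> h}"
  let ?T = "{z :: plane. 0 \<le> z $ 1 - 0 \<and> z $ 1 - 0 \<le> x \<and> 0 \<le> z $ 2 - real j \<and> z $ 2 - real j \<le> h}"
  let ?JR = "{z :: plane. 0 \<le> z $ 1 \<and> z $ 1 \<le> x \<and> 0 \<le> z $ 2 \<and> z $ 2 \<le> j}"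
  have strip: "packs {z. 0 \<le> z $ 1 \<and> z $ 1 \<le> l \<and> 0 \<le> z $ 2 \<and> z $ 2 \<le> h}
    (l * h - 2 * l / Q - 12000 * real q ^ 3)" if "100 * Q \<le> l" for l
    using packs_strip[OF q, of h l n] that h by (simp add: Q_def)
  have J: "packs ?J (real j * j)"
    using packable_block[of 0 j 0 j] by (rule packs_of_packable) simp
  have R: "packs ?R (j * h - 2 * real j / Q - 12000 * real q ^ 3)"
  proof -
    have "100 * Q \<le> real j" using x2 j by linarith
    from packs_swap[of "\<lambda>a b. 0 \<le> a \<and> a \<le> real j \<and> 0 \<le> b \<and> b \<le> h", OF strip[OF this]]
    show ?thesis
      by (rule packs_translate[of "\<lambda>a b. 0 \<le> b \<and> b \<le> real j \<and> 0 \<le> a \<and> a \<le> h"])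
  qed
  have T: "packs ?T (x * h - 2 * x / Q - 12000 * real q ^ 3)"
  proof -
    have "100 * Q \<le> x" using x2 x0 by linarith
    from strip[OF this] show ?thesis
      by (rule packs_translate[of "\<lambda>a b. 0 \<le> a \<and> a \<le> x \<and> 0 \<le> b \<and> b \<le> h"])
  qed
  have JR: "packs ?JR (real j * j + (j * h - 2 * real j / Q - 12000 * real q ^ 3))"
    by (rule packs_Un_line[OF J R, where \<alpha> = 1 and \<beta> = 0 and \<gamma> = j]) (use j h(2) x2 in auto)
  have "packs ?S ((real j * j + (j * h - 2 * real j / Q - 12000 * real q ^ 3)) + (x * h - 2 * x / Q - 12000 * real q ^ 3))"
    by (rule packs_Un_line[OF JR T, where \<alpha> = 0 and \<beta> = 1 and \<gamma> = j]) (use j h(2) x2 in auto)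
  moreover have "x\<^sup>2 - 200000 * r ^ 3
    \<le> (real j * j + (j * h - 2 * real j / Q - 12000 * real q ^ 3)) + (x * h - 2 * x / Q - 12000 * real q ^ 3)"
  proof -
    have "x / Q \<le> x / r ^ 2" using Q Q1 x0 r by (intro divide_left_mono mult_pos_pos) auto
    also have "x / r ^ 2 = r ^ 3" using r by (simp add: r5[symmetric] flip: power_diff)
    finally have "x / Q \<le> r ^ 3" .
    then have xQ: "2 * x / Q \<le> 2 * r ^ 3" by simp
    have "2 * real j / Q \<le> 2 * x / Q" using j h(2) Q1 by (intro divide_right_mono) auto
    then have jQ: "2 * real j / Q \<le> 2 * r ^ 3" using xQ by linarith
    have sum: "real j * j + j * h + x * h = x\<^sup>2" unfolding j by (simp add: power2_eq_square algebra_simps)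
    \<comment> \<open>Two strips lose \<open>12000 * q ^ 3 \<le> 96000 * r ^ 3\<close> each at their
      ends and \<open>2 * r ^ 3\<close> each in the rods, in all less than
      \<open>200000 * r ^ 3\<close>.\<close>
    have "s - 200000 * k \<le> (jj + (jh - a - 12000 * p)) + (xh - b - 12000 * p)"
      if "a \<le> 2 * k" "b \<le> 2 * k" "jj + jh + xh = s" "0 \<le> k" "p \<le> 8 * k"
      for s k jj jh xh a b p :: real
      using that by simp
    from this[OF jQ xQ sum _ q3] show ?thesis using r by simp
  qed
  moreover have "?S = big_square x"
    by (auto simp: big_square_def mem_box_cart forall_2)
  ultimately have "packs (big_square x) (x\<^sup>2 - 200000 * r ^ 3)"
    by (elim packs_mono) simp_all
  then obtain m where m: "packable (big_square x) m" "x\<^sup>2 - 200000 * r ^ 3 \<le> m"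
    unfolding packs_def by blast
  have "wasted_space x \<le> x\<^sup>2 - m" using m(1) x0 by (intro wasted_space_le) auto
  then show "wasted_space x \<le> 200000 * x powr (3 / 5)"
    using m(2) unfolding r3 by linarith
qed


end
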